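(* (i) Let $\mathcal{C}=(\mathcal{C},\Omega,\triangle)$ be a left triangulated category, $\mathcal{X}$ an additive category, and $i:\mathcal{X}\to\mathcal{C}$ a left coreflective functor with coreflector $Q$. Then $(Q\Omega i,\triangle_{\mathcal{X}})$ is a left triangulated structure on $\mathcal{X}$. (ii) Let $\mathcal{D}=(\mathcal{D},\Sigma,\bigtriangledown)$ be a right triangulated category, $\mathcal{Y}$ an additive category, and $j:\mathcal{Y}\to\mathcal{D}$ a right reflective functor with reflector $R$. Then $(R\Sigma j,\bigtriangledown_{\mathcal{Y}})$ is a right triangulated structure on $\mathcal{Y}$.
   Context: **Left triangulated structure.** Let $\mathcal{C}$ be an additive category with an additive endofunctor $\Omega$. A left triangle is a diagram $\Omega(A)\xrightarrow{h}C\xrightarrow{g}B\xrightarrow{f}A$; a morphism from it to $\Omega(A')\xrightarrow{h'}C'\xrightarrow{g'}B'\xrightarrow{f'}A'$ is a triple $(\gamma:C\to C',\beta:B\to B',\alpha:A\to A')$ with $\gamma h=h'\Omega(\alpha)$, $\beta g=g'\gamma$, $\alpha f=f'\beta$. A class $\triangle$ of left triangles gives a left triangulated structure $(\Omega,\triangle)$ if $\triangle$ is closed under isomorphism and: (LT1) every $f:B\to A$ fits in some $\Omega(A)\to C\to B\xrightarrow{f}A$ in $\triangle$, and $0\to A\xrightarrow{1_A}A\to 0$ is in $\triangle$ for all $A$; (LT2) if $\Omega(A)\xrightarrow{h}C\xrightarrow{g}B\xrightarrow{f}A$ is in $\triangle$ then so is $\Omega(B)\xrightarrow{-\Omega(f)}\Omega(A)\xrightarrow{h}C\xrightarrow{g}B$;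 (LT3) given two triangles $\Omega(A)\xrightarrow{h}C\xrightarrow{g}B\xrightarrow{f}A$ and $\Omega(A')\xrightarrow{h'}C'\xrightarrow{g'}B'\xrightarrow{f'}A'$ in $\triangle$ and $\beta:B\to B'$, $\alpha:A\to A'$ with $\alpha f=f'\beta$, there is $\gamma:C\to C'$ making $(\gamma,\beta,\alpha)$ a morphism of left triangles; (LT4) given $g:C\to B$ and $f:B\to A$, there are triangles $\Omega(B)\xrightarrow{m}D\xrightarrow{k}C\xrightarrow{g}B$, $\Omega(A)\xrightarrow{n}E\xrightarrow{h}C\xrightarrow{fg}A$, $\Omega(A)\xrightarrow{i}F\xrightarrow{l}B\xrightarrow{f}A$ in $\triangle$ and morphisms $\alpha:D\to E$, $\beta:E\to F$ with $\alpha m=n\Omega(f)$, $h\alpha=k$, $\beta n=i$, $l\beta=gh$, such that $\Omega(F)\xrightarrow{m\Omega(l)}D\xrightarrow{\alpha}E\xrightarrow{\beta}F$ is in $\triangle$. A left triangulated category is a triple $(\mathcal{C},\Omega,\triangle)$. Right triangulated structures $(\Sigma,\bigtriangledown)$, with right triangles $A\to B\to C\to\Sigma(A)$, and right triangulated categories are defined dually (the opposite data on the opposite category is left triangulated). **Left coreflective functor.** Let $(\mathcal{C},\Omega,\triangle)$ be left triangulated and $\mathcal{X}$ additive. A fully faithful functor $i:\mathcal{X}\to\mathcal{C}$ is left coreflective if: (a) it has a right adjoint $Q$ (the coreflector); (b) for every $f:B\to A$ in $\mathcal{C}$ and left triangles $\Omega(A)\to C\to B\xrightarrow{f}A$ and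 $\Omega iQ(A)\to D\to iQ(B)\xrightarrow{iQ(f)}iQ(A)$ in $\triangle$, if $t:D\to C$ is a morphism provided by (LT3) such that $(t,\varepsilon_B,\varepsilon_A)$ is a morphism from the second triangle to the first ($\varepsilon:iQ\to\mathrm{id}_{\mathcal{C}}$ the counit), then $Q(t)$ is an isomorphism. **Right reflective functor (dual).** Let $(\mathcal{D},\Sigma,\bigtriangledown)$ be right triangulated and $\mathcal{Y}$ additive. A fully faithful functor $j:\mathcal{Y}\to\mathcal{D}$ is right reflective if: (a) it has a left adjoint $R$ (the reflector); (b) for every $f:X\to Y$ in $\mathcal{D}$ and right triangles $X\xrightarrow{f}Y\to C\to\Sigma(X)$ and $jR(X)\xrightarrow{jR(f)}jR(Y)\to D\to\Sigma jR(X)$ in $\bigtriangledown$, if $t:C\to D$ is a morphism provided by the dual of (LT3) completing the unit maps $X\to jR(X)$, $Y\to jR(Y)$ to a morphism from the first triangle to the second, then $R(t)$ is an isomorphism. **Induced triangles.** For $i$ left coreflective, the unit $\eta:\mathrm{id}_{\mathcal{X}}\to Qi$ is an isomorphism. $\triangle_{\mathcal{X}}$ is the class of left triangles in $\mathcal{X}$ (with respect to the endofunctor $Q\Omega i$) isomorphic to $Q\Omega i(A)\xrightarrow{Q(h)}Q(C)\xrightarrow{\eta_B^{-1}Q(g)}B\xrightarrow{f}A$ for some $f:B\to A$ in $\mathcal{X}$ and some $\Omega i(A)\xrightarrow{h}C\xrightarrow{g}i(B)\xrightarrow{i(f)}i(A)$ in $\triangle$. Dually, for $j$ right reflective, with counit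 isomorphism $\theta:Rj\to\mathrm{id}_{\mathcal{Y}}$, $\bigtriangledown_{\mathcal{Y}}$ is the class of right triangles in $\mathcal{Y}$ (with respect to $R\Sigma j$) isomorphic to $A\xrightarrow{f}B\xrightarrow{R(g)\theta_B^{-1}}R(C)\xrightarrow{R(h)}R\Sigma j(A)$ for some $f:A\to B$ in $\mathcal{Y}$ and some $j(A)\xrightarrow{j(f)}j(B)\xrightarrow{g}C\xrightarrow{h}\Sigma j(A)$ in $\bigtriangledown$. *)

theory Defs
  imports "HOL-Algebra.Group"
begin

section \<open>Categories, functors, adjunctions\<close>

text \<open>
  A category is given by a set of objects and a set of arrows, each arrow having a unique
  domain and codomain.  \<open>g \<cdot> f\<close> is the composite ``first \<open>f\<close>, then \<open>g\<close>''.  All operations are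
  relevant only on objects, arrows and composable pairs; their other values are arbitrary.
\<close>

record ('o, 'a) cat =
  Obj :: "'o set"
  Arr :: "'a set"
  Dom :: "'a \<Rightarrow> 'o"
  Cod :: "'a \<Rightarrow> 'o"
  Id :: "'o \<Rightarrow> 'a"
  Comp :: "'a \<Rightarrow> 'a \<Rightarrow> 'a" (infixr "\<cdot>\<index>" 70)

definition Hom :: "('o, 'a, 'z) cat_scheme \<Rightarrow> 'o \<Rightarrow> 'o \<Rightarrow> 'a set" where
  "Hom C A B = {f \<in> Arr C. Dom C f = A \<and> Cod C f = B}"

locale category =
  fixes C :: "('o, 'a, 'z) cat_scheme" (structure)
  assumes dom_in_Obj: "f \<in> Arr C \<Longrightarrow> Dom C f \<in> Obj C"
    and cod_in_Obj: "f \<in> Arr C \<Longrightarrow> Cod C f \<in> Obj C"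
    and id_in_Hom: "A \<in> Obj C \<Longrightarrow> Id C A \<in> Hom C A A"
    and comp_in_Hom: "\<lbrakk>f \<in> Hom C A B; g \<in> Hom C B D\<rbrakk> \<Longrightarrow> g \<cdot> f \<in> Hom C A D"
    and id_left: "f \<in> Hom C A B \<Longrightarrow> Id C B \<cdot> f = f"
    and id_right: "f \<in> Hom C A B \<Longrightarrow> f \<cdot> Id C A = f"
    and assoc: "\<lbrakk>f \<in> Hom C A B; g \<in> Hom C B D; h \<in> Hom C D E\<rbrakk>
                  \<Longrightarrow> (h \<cdot> g) \<cdot> f = h \<cdot> (g \<cdot> f)"

definition inverse_arrows :: "('o, 'a, 'z) cat_scheme \<Rightarrow> 'a \<Rightarrow> 'a \<Rightarrow> bool" where
  "inverse_arrows C f g \<longleftrightarrow>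
     f \<in> Arr C \<and> g \<in> Hom C (Cod C f) (Dom C f) \<and>
     g \<cdot>\<^bsub>C\<^esub> f = Id C (Dom C f) \<and> f \<cdot>\<^bsub>C\<^esub> g = Id C (Cod C f)"

definition is_iso :: "('o, 'a, 'z) cat_scheme \<Rightarrow> 'a \<Rightarrow> bool" where
  "is_iso C f \<longleftrightarrow> (\<exists>g. inverse_arrows C f g)"

definition inv_arr :: "('o, 'a, 'z) cat_scheme \<Rightarrow> 'a \<Rightarrow> 'a" where
  "inv_arr C f = (THE g. inverse_arrows C f g)"

record ('o, 'a, 'p, 'b) func =
  omap :: "'o \<Rightarrow> 'p"
  amap :: "'a \<Rightarrow> 'b"

definition func_comp ::
    "('p, 'b, 'q, 'c) func \<Rightarrow> ('o, 'a, 'p, 'b) func \<Rightarrow> ('o, 'a, 'q, 'c) func"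
    (infixr "\<circ>\<^sub>F" 55) where
  "G \<circ>\<^sub>F F = \<lparr>omap = omap G \<circ> omap F, amap = amap G \<circ> amap F\<rparr>"

locale cat_functor = C: category C + D: category D
  for C :: "('o, 'a, 'y) cat_scheme" and D :: "('p, 'b, 'z) cat_scheme" +
  fixes F :: "('o, 'a, 'p, 'b) func"
  assumes omap_in_Obj: "A \<in> Obj C \<Longrightarrow> omap F A \<in> Obj D"
    and amap_in_Hom: "f \<in> Hom C A B \<Longrightarrow> amap F f \<in> Hom D (omap F A) (omap F B)"
    and amap_id: "A \<in> Obj C \<Longrightarrow> amap F (Id C A) = Id D (omap F A)"
    and amap_comp: "\<lbrakk>f \<in> Hom C A B; g \<in> Hom C B E\<rbrakk>
                      \<Longrightarrow> amap F (g \<cdot>\<^bsub>C\<^esub> f) = amap F g \<cdot>\<^bsub>D\<^esub> amap F f"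

locale fully_faithful_functor = cat_functor +
  assumes amap_bij: "\<lbrakk>A \<in> Obj C; B \<in> Obj C\<rbrakk>
      \<Longrightarrow> bij_betw (amap F) (Hom C A B) (Hom D (omap F A) (omap F B))"

text \<open>\<open>L : C \<rightarrow> D\<close> is left adjoint to \<open>R : D \<rightarrow> C\<close>, with unit \<open>\<eta>\<close> and counit \<open>\<epsilon>\<close>.\<close>

locale adjunction = L: cat_functor C D L + R: cat_functor D C R
  for C :: "('o, 'a, 'y) cat_scheme" and D :: "('p, 'b, 'z) cat_scheme"
    and L :: "('o, 'a, 'p, 'b) func" and R :: "('p, 'b, 'o, 'a) func" +
  fixes \<eta> :: "'o \<Rightarrow> 'a" and \<epsilon> :: "'p \<Rightarrow> 'b"
  assumes unit_in_Hom: "A \<in> Obj C \<Longrightarrow> \<eta> A \<in> Hom C A (omap R (omap L A))"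
    and unit_natural: "f \<in> Hom C A B \<Longrightarrow> \<eta> B \<cdot>\<^bsub>C\<^esub> f = amap R (amap L f) \<cdot>\<^bsub>C\<^esub> \<eta> A"
    and counit_in_Hom: "U \<in> Obj D \<Longrightarrow> \<epsilon> U \<in> Hom D (omap L (omap R U)) U"
    and counit_natural: "g \<in> Hom D U V \<Longrightarrow> \<epsilon> V \<cdot>\<^bsub>D\<^esub> amap L (amap R g) = g \<cdot>\<^bsub>D\<^esub> \<epsilon> U"
    and triangle_L: "A \<in> Obj C \<Longrightarrow> \<epsilon> (omap L A) \<cdot>\<^bsub>D\<^esub> amap L (\<eta> A) = Id D (omap L A)"
    and triangle_R: "U \<in> Obj D \<Longrightarrow> amap R (\<epsilon> U) \<cdot>\<^bsub>C\<^esub> \<eta> (omap R U) = Id C (omap R U)"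


section \<open>Additive categories\<close>

record ('o, 'a) acat = "('o, 'a) cat" +
  Plus :: "'a \<Rightarrow> 'a \<Rightarrow> 'a" (infixl "\<oplus>\<index>" 65)
  Zero :: "'o \<Rightarrow> 'o \<Rightarrow> 'a"

definition hom_group :: "('o, 'a) acat \<Rightarrow> 'o \<Rightarrow> 'o \<Rightarrow> 'a monoid" where
  "hom_group C A B = \<lparr>carrier = Hom C A B, mult = Plus C, one = Zero C A B\<rparr>"

definition neg :: "('o, 'a) acat \<Rightarrow> 'a \<Rightarrow> 'a" where
  "neg C f = inv\<^bsub>hom_group C (Dom C f) (Cod C f)\<^esub> f"

definition zero_object :: "('o, 'a, 'z) cat_scheme \<Rightarrow> 'o \<Rightarrow> bool" where
  "zero_object C Z \<longleftrightarrow>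
     Z \<in> Obj C \<and> (\<forall>A\<in>Obj C. (\<exists>!f. f \<in> Hom C Z A) \<and> (\<exists>!f. f \<in> Hom C A Z))"

locale additive_category = category C
  for C :: "('o, 'a) acat" (structure) +
  assumes hom_group: "\<lbrakk>A \<in> Obj C; B \<in> Obj C\<rbrakk> \<Longrightarrow> comm_group (hom_group C A B)"
    and comp_plus_left: "\<lbrakk>f \<in> Hom C A B; g \<in> Hom C B D; g' \<in> Hom C B D\<rbrakk>
            \<Longrightarrow> (g \<oplus> g') \<cdot> f = (g \<cdot> f) \<oplus> (g' \<cdot> f)"
    and comp_plus_right: "\<lbrakk>f \<in> Hom C A B; f' \<in> Hom C A B; g \<in> Hom C B D\<rbrakk>
            \<Longrightarrow> g \<cdot> (f \<oplus> f') = (g \<cdot> f) \<oplus> (g \<cdot> f')"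
    and has_zero_object: "\<exists>Z. zero_object C Z"
    and has_biproducts: "\<lbrakk>A \<in> Obj C; B \<in> Obj C\<rbrakk> \<Longrightarrow>
          \<exists>P i\<^sub>1 i\<^sub>2 p\<^sub>1 p\<^sub>2. i\<^sub>1 \<in> Hom C A P \<and> i\<^sub>2 \<in> Hom C B P \<and> p\<^sub>1 \<in> Hom C P A \<and> p\<^sub>2 \<in> Hom C P B \<and>
            p\<^sub>1 \<cdot> i\<^sub>1 = Id C A \<and> p\<^sub>2 \<cdot> i\<^sub>2 = Id C B \<and>
            p\<^sub>2 \<cdot> i\<^sub>1 = Zero C A B \<and> p\<^sub>1 \<cdot> i\<^sub>2 = Zero C B A \<and>
            (i\<^sub>1 \<cdot> p\<^sub>1) \<oplus> (i\<^sub>2 \<cdot> p\<^sub>2) = Id C P"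

locale additive_functor = C: additive_category C + D: additive_category D + cat_functor C D F
  for C :: "('o, 'a) acat" and D :: "('p, 'b) acat" and F :: "('o, 'a, 'p, 'b) func" +
  assumes amap_hom: "\<lbrakk>A \<in> Obj C; B \<in> Obj C\<rbrakk>
            \<Longrightarrow> amap F \<in> hom (hom_group C A B) (hom_group D (omap F A) (omap F B))"


section \<open>Left triangulated categories\<close>

text \<open>
  The left triangle \<open>\<Omega>(A) \<rightarrow> C \<rightarrow> B \<rightarrow> A\<close> with arrows \<open>h\<close>, \<open>g\<close>, \<open>f\<close> (from left to right) is encoded
  as \<open>(h, g, f)\<close>; its objects are recovered as \<open>A = Cod f\<close>, \<open>B = Dom f\<close>, \<open>C = Dom g\<close>.
\<close>

type_synonym 'a triangle = "'a \<times> 'a \<times> 'a"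

fun left_triangle :: "('o, 'a) acat \<Rightarrow> ('o, 'a, 'o, 'a) func \<Rightarrow> 'a triangle \<Rightarrow> bool" where
  "left_triangle C \<Omega> (h, g, f) \<longleftrightarrow>
     f \<in> Arr C \<and> g \<in> Arr C \<and> h \<in> Arr C \<and>
     Cod C g = Dom C f \<and> Cod C h = Dom C g \<and> Dom C h = omap \<Omega> (Cod C f)"

fun left_triangle_morphism ::
    "('o, 'a) acat \<Rightarrow> ('o, 'a, 'o, 'a) func \<Rightarrow> 'a triangle \<Rightarrow> 'a triangle
      \<Rightarrow> 'a \<times> 'a \<times> 'a \<Rightarrow> bool" where
  "left_triangle_morphism C \<Omega> (h, g, f) (h', g', f') (\<gamma>, \<beta>, \<alpha>) \<longleftrightarrow>
     left_triangle C \<Omega> (h, g, f) \<and> left_triangle C \<Omega> (h', g', f') \<and>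
     \<gamma> \<in> Hom C (Dom C g) (Dom C g') \<and>
     \<beta> \<in> Hom C (Dom C f) (Dom C f') \<and>
     \<alpha> \<in> Hom C (Cod C f) (Cod C f') \<and>
     \<gamma> \<cdot>\<^bsub>C\<^esub> h = h' \<cdot>\<^bsub>C\<^esub> amap \<Omega> \<alpha> \<and> \<beta> \<cdot>\<^bsub>C\<^esub> g = g' \<cdot>\<^bsub>C\<^esub> \<gamma> \<and> \<alpha> \<cdot>\<^bsub>C\<^esub> f = f' \<cdot>\<^bsub>C\<^esub> \<beta>"

definition left_triangle_isomorphic ::
    "('o, 'a) acat \<Rightarrow> ('o, 'a, 'o, 'a) func \<Rightarrow> 'a triangle \<Rightarrow> 'a triangle \<Rightarrow> bool" where
  "left_triangle_isomorphic C \<Omega> T T' \<longleftrightarrow>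
     (\<exists>\<gamma> \<beta> \<alpha>. left_triangle_morphism C \<Omega> T T' (\<gamma>, \<beta>, \<alpha>) \<and>
              is_iso C \<gamma> \<and> is_iso C \<beta> \<and> is_iso C \<alpha>)"

text \<open>
  In \<open>LT1_id\<close>, the triangle \<open>0 \<rightarrow> A \<rightarrow> A \<rightarrow> 0\<close> is the left triangle \<open>\<Omega>(Z) \<rightarrow> A \<rightarrow> A \<rightarrow> Z\<close> for a zero
  object \<open>Z\<close>; \<open>\<Omega>(Z)\<close> is again a zero object since \<open>\<Omega>\<close> is additive.  As \<open>\<Delta>\<close> is closed under
  isomorphism, it does not matter whether one or all zero objects are considered.
\<close>

locale left_triangulated = additive_category C + additive_functor C C \<Omega>
  for C :: "('o, 'a) acat" (structure) and \<Omega> :: "('o, 'a, 'o, 'a) func" +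
  fixes \<Delta> :: "'a triangle set"
  assumes left_triangles: "T \<in> \<Delta> \<Longrightarrow> left_triangle C \<Omega> T"
    and iso_closed: "\<lbrakk>T \<in> \<Delta>; left_triangle_isomorphic C \<Omega> T T'\<rbrakk> \<Longrightarrow> T' \<in> \<Delta>"
    and LT1: "f \<in> Arr C \<Longrightarrow> \<exists>h g. (h, g, f) \<in> \<Delta>"
    and LT1_id: "\<lbrakk>zero_object C Z; A \<in> Obj C\<rbrakk>
          \<Longrightarrow> (Zero C (omap \<Omega> Z) A, Id C A, Zero C A Z) \<in> \<Delta>"
    and LT2: "(h, g, f) \<in> \<Delta> \<Longrightarrow> (neg C (amap \<Omega> f), h, g) \<in> \<Delta>"
    and LT3: "\<lbrakk>(h, g, f) \<in> \<Delta>; (h', g', f') \<in> \<Delta>;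
               \<beta> \<in> Hom C (Dom C f) (Dom C f'); \<alpha> \<in> Hom C (Cod C f) (Cod C f');
               \<alpha> \<cdot> f = f' \<cdot> \<beta>\<rbrakk>
          \<Longrightarrow> \<exists>\<gamma>. left_triangle_morphism C \<Omega> (h, g, f) (h', g', f') (\<gamma>, \<beta>, \<alpha>)"
    and LT4: "\<lbrakk>g \<in> Arr C; f \<in> Arr C; Cod C g = Dom C f\<rbrakk> \<Longrightarrow>
          \<exists>m k n h i l \<alpha> \<beta>.
            (m, k, g) \<in> \<Delta> \<and> (n, h, f \<cdot> g) \<in> \<Delta> \<and> (i, l, f) \<in> \<Delta> \<and>
            \<alpha> \<in> Hom C (Dom C k) (Dom C h) \<and> \<beta> \<in> Hom C (Dom C h) (Dom C l) \<and>
            \<alpha> \<cdot> m = n \<cdot> amap \<Omega> f \<and> h \<cdot> \<alpha> = k \<and> \<beta> \<cdot> n = i \<and> l \<cdot> \<beta> = g \<cdot> h \<and>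
            (m \<cdot> amap \<Omega> l, \<alpha>, \<beta>) \<in> \<Delta>"


section \<open>Right triangulated categories\<close>

text \<open>
  The right triangle \<open>A \<rightarrow> B \<rightarrow> C \<rightarrow> \<Sigma>(A)\<close> with arrows \<open>f\<close>, \<open>g\<close>, \<open>h\<close> (from left to right) is encoded
  as \<open>(f, g, h)\<close>.  It becomes the left triangle \<open>(h, g, f)\<close> of the opposite category.  A functor
  and its opposite have the same underlying maps.
\<close>

definition op_cat :: "('o, 'a) acat \<Rightarrow> ('o, 'a) acat" where
  "op_cat C = C\<lparr>Dom := Cod C, Cod := Dom C, Comp := \<lambda>g f. f \<cdot>\<^bsub>C\<^esub> g, Zero := \<lambda>A B. Zero C B A\<rparr>"

fun op_triangle :: "'a triangle \<Rightarrow> 'a triangle" where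
  "op_triangle (f, g, h) = (h, g, f)"

definition right_triangulated ::
    "('o, 'a) acat \<Rightarrow> ('o, 'a, 'o, 'a) func \<Rightarrow> 'a triangle set \<Rightarrow> bool" where
  "right_triangulated C \<Sigma> \<V> \<longleftrightarrow> left_triangulated (op_cat C) \<Sigma> (op_triangle ` \<V>)"

fun right_triangle :: "('o, 'a) acat \<Rightarrow> ('o, 'a, 'o, 'a) func \<Rightarrow> 'a triangle \<Rightarrow> bool" where
  "right_triangle C \<Sigma> (f, g, h) \<longleftrightarrow>
     f \<in> Arr C \<and> g \<in> Arr C \<and> h \<in> Arr C \<and>
     Cod C f = Dom C g \<and> Cod C g = Dom C h \<and> Cod C h = omap \<Sigma> (Dom C f)"

fun right_triangle_morphism ::
    "('o, 'a) acat \<Rightarrow> ('o, 'a, 'o, 'a) func \<Rightarrow> 'a triangle \<Rightarrow> 'a triangle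
      \<Rightarrow> 'a \<times> 'a \<times> 'a \<Rightarrow> bool" where
  "right_triangle_morphism C \<Sigma> (f, g, h) (f', g', h') (\<alpha>, \<beta>, \<gamma>) \<longleftrightarrow>
     right_triangle C \<Sigma> (f, g, h) \<and> right_triangle C \<Sigma> (f', g', h') \<and>
     \<alpha> \<in> Hom C (Dom C f) (Dom C f') \<and>
     \<beta> \<in> Hom C (Cod C f) (Cod C f') \<and>
     \<gamma> \<in> Hom C (Cod C g) (Cod C g') \<and>
     \<beta> \<cdot>\<^bsub>C\<^esub> f = f' \<cdot>\<^bsub>C\<^esub> \<alpha> \<and> \<gamma> \<cdot>\<^bsub>C\<^esub> g = g' \<cdot>\<^bsub>C\<^esub> \<beta> \<and> amap \<Sigma> \<alpha> \<cdot>\<^bsub>C\<^esub> h = h' \<cdot>\<^bsub>C\<^esub> \<gamma>"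

definition right_triangle_isomorphic ::
    "('o, 'a) acat \<Rightarrow> ('o, 'a, 'o, 'a) func \<Rightarrow> 'a triangle \<Rightarrow> 'a triangle \<Rightarrow> bool" where
  "right_triangle_isomorphic C \<Sigma> T T' \<longleftrightarrow>
     (\<exists>\<alpha> \<beta> \<gamma>. right_triangle_morphism C \<Sigma> T T' (\<alpha>, \<beta>, \<gamma>) \<and>
              is_iso C \<alpha> \<and> is_iso C \<beta> \<and> is_iso C \<gamma>)"


section \<open>Coreflective and reflective functors, induced triangles\<close>

text \<open>The adjunction \<open>(Q, \<eta>, \<epsilon>)\<close> is part of the data; \<open>i\<close> is not assumed to be additive.\<close>

definition left_coreflective ::
    "('o, 'a) acat \<Rightarrow> ('o, 'a, 'o, 'a) func \<Rightarrow> 'a triangle set \<Rightarrow> ('p, 'b) acat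
      \<Rightarrow> ('p, 'b, 'o, 'a) func \<Rightarrow> ('o, 'a, 'p, 'b) func \<Rightarrow> ('p \<Rightarrow> 'b) \<Rightarrow> ('o \<Rightarrow> 'a) \<Rightarrow> bool" where
  "left_coreflective C \<Omega> \<Delta> X i Q \<eta> \<epsilon> \<longleftrightarrow>
     fully_faithful_functor X C i \<and>
     adjunction X C i Q \<eta> \<epsilon> \<and>
     (\<forall>f h g h' g' t.
        f \<in> Arr C \<longrightarrow> (h, g, f) \<in> \<Delta> \<longrightarrow> (h', g', amap i (amap Q f)) \<in> \<Delta> \<longrightarrow>
        left_triangle_morphism C \<Omega> (h', g', amap i (amap Q f)) (h, g, f)
          (t, \<epsilon> (Dom C f), \<epsilon> (Cod C f)) \<longrightarrow>
        is_iso X (amap Q t))"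

definition induced_left_triangles ::
    "('o, 'a, 'o, 'a) func \<Rightarrow> 'a triangle set \<Rightarrow> ('p, 'b) acat
      \<Rightarrow> ('p, 'b, 'o, 'a) func \<Rightarrow> ('o, 'a, 'p, 'b) func \<Rightarrow> ('p \<Rightarrow> 'b) \<Rightarrow> 'b triangle set" where
  "induced_left_triangles \<Omega> \<Delta> X i Q \<eta> =
     {T. \<exists>f h g. f \<in> Arr X \<and> (h, g, amap i f) \<in> \<Delta> \<and>
           left_triangle_isomorphic X (Q \<circ>\<^sub>F \<Omega> \<circ>\<^sub>F i) T
             (amap Q h, inv_arr X (\<eta> (Dom X f)) \<cdot>\<^bsub>X\<^esub> amap Q g, f)}"

definition right_reflective ::
    "('o, 'a) acat \<Rightarrow> ('o, 'a, 'o, 'a) func \<Rightarrow> 'a triangle set \<Rightarrow> ('p, 'b) acat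
      \<Rightarrow> ('p, 'b, 'o, 'a) func \<Rightarrow> ('o, 'a, 'p, 'b) func \<Rightarrow> ('o \<Rightarrow> 'a) \<Rightarrow> ('p \<Rightarrow> 'b) \<Rightarrow> bool" where
  "right_reflective D \<Sigma> \<V> Y j R \<eta> \<theta> \<longleftrightarrow>
     fully_faithful_functor Y D j \<and>
     adjunction D Y R j \<eta> \<theta> \<and>
     (\<forall>f g h g' h' t.
        f \<in> Arr D \<longrightarrow> (f, g, h) \<in> \<V> \<longrightarrow> (amap j (amap R f), g', h') \<in> \<V> \<longrightarrow>
        right_triangle_morphism D \<Sigma> (f, g, h) (amap j (amap R f), g', h')
          (\<eta> (Dom D f), \<eta> (Cod D f), t) \<longrightarrow>
        is_iso Y (amap R t))"

definition induced_right_triangles ::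
    "('o, 'a, 'o, 'a) func \<Rightarrow> 'a triangle set \<Rightarrow> ('p, 'b) acat
      \<Rightarrow> ('p, 'b, 'o, 'a) func \<Rightarrow> ('o, 'a, 'p, 'b) func \<Rightarrow> ('p \<Rightarrow> 'b) \<Rightarrow> 'b triangle set" where
  "induced_right_triangles \<Sigma> \<V> Y j R \<theta> =
     {T. \<exists>f g h. f \<in> Arr Y \<and> (amap j f, g, h) \<in> \<V> \<and>
           right_triangle_isomorphic Y (R \<circ>\<^sub>F \<Sigma> \<circ>\<^sub>F j) T
             (f, amap R g \<cdot>\<^bsub>Y\<^esub> inv_arr Y (\<theta> (Cod Y f)), amap R h)}"

end

theory Submission
  imports Defs
begin

text \<open>
  As \<open>i\<close> is fully faithful, the unit \<open>\<eta>\<close> is invertible, \<open>i\<close> carries its inverse \<open>\<kappa>\<close> to the counit at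
  objects \<open>i A\<close>, and \<open>Q \<epsilon>\<close> is inverse to \<open>\<eta>\<close> at objects \<open>Q U\<close>.  As adjoint functors between
  additive categories, \<open>i\<close> and \<open>Q\<close> are additive (\<open>left_adjoint_additive\<close>,
  \<open>right_adjoint_additive\<close>), so \<open>\<Omega>' = Q \<Omega> i\<close> is an additive endofunctor of \<open>X\<close>.

  Up to an isomorphism that fixes \<open>f\<close>, an induced triangle on \<open>f\<close> is the image under \<open>Q\<close> of a
  triangle on \<open>i f\<close> (\<open>inducedE\<close>, \<open>inducedI\<close>).  Hence the existence of triangles, the completion of
  morphisms and the commutative part of the octahedral axiom are obtained by applying \<open>Q\<close> to their
  counterparts in \<open>C\<close>.  What remains is that certain triangles are induced although their last
  arrow in \<open>C\<close> does not lie in the image of \<open>i\<close>: the rotated triangle and the last triangle of the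
  octahedral axiom.  Both follow from \<open>coreflector_triangle\<close>: if \<open>\<Omega>A \<rightarrow> C \<rightarrow> B \<rightarrow> A\<close> is a triangle
  with arrows \<open>h, g, f\<close>, then \<open>(Q(h \<Omega>\<epsilon>\<^sub>A), Q g, Q f)\<close> is an induced triangle.  Indeed, a triangle on
  \<open>i Q f\<close> maps to the given one by some \<open>t\<close> over \<open>\<epsilon>\<^sub>B\<close> and \<open>\<epsilon>\<^sub>A\<close>, and \<open>Q t\<close> is invertible because \<open>i\<close>
  is left coreflective.

  The statement on reflective functors is the same statement for the opposite categories.
\<close>

section \<open>Composition, isomorphisms and functors on arrows\<close>

context category
begin

lemma dom_Obj [simp]: "f \<in> Arr C \<Longrightarrow> Dom C f \<in> Obj C"
  by (rule dom_in_Obj)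

lemma cod_Obj [simp]: "f \<in> Arr C \<Longrightarrow> Cod C f \<in> Obj C"
  by (rule cod_in_Obj)

lemma id_arr [simp]:
  assumes "A \<in> Obj C"
  shows "Id C A \<in> Arr C" "Dom C (Id C A) = A" "Cod C (Id C A) = A"
  using id_in_Hom[OF assms] by (auto simp: Hom_def)

lemma comp_arr [simp]:
  assumes "f \<in> Arr C" "g \<in> Arr C" "Cod C f = Dom C g"
  shows "g \<cdot> f \<in> Arr C" "Dom C (g \<cdot> f) = Dom C f" "Cod C (g \<cdot> f) = Cod C g"
  using comp_in_Hom[of f "Dom C f" "Dom C g" g "Cod C g"] assms by (auto simp: Hom_def)

lemma comp_id_left [simp]: "\<lbrakk>f \<in> Arr C; Cod C f = B\<rbrakk> \<Longrightarrow> Id C B \<cdot> f = f"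
  using id_left[of f "Dom C f" B] by (auto simp: Hom_def)

lemma comp_id_right [simp]: "\<lbrakk>f \<in> Arr C; Dom C f = A\<rbrakk> \<Longrightarrow> f \<cdot> Id C A = f"
  using id_right[of f A "Cod C f"] by (auto simp: Hom_def)

lemma comp_assoc [simp]:
  "\<lbrakk>f \<in> Arr C; g \<in> Arr C; h \<in> Arr C; Cod C f = Dom C g; Cod C g = Dom C h\<rbrakk>
    \<Longrightarrow> (h \<cdot> g) \<cdot> f = h \<cdot> (g \<cdot> f)"
  using assoc[of f "Dom C f" "Dom C g" g "Dom C h" h "Cod C h"] by (auto simp: Hom_def)

text \<open>Rewriting inside a composite that is bracketed to the right.\<close>

lemma comp_cong:
  "\<lbrakk>g \<cdot> f = g' \<cdot> f'; k \<in> Arr C; f \<in> Arr C; g \<in> Arr C; f' \<in> Arr C; g' \<in> Arr C;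
    Cod C k = Dom C f; Cod C f = Dom C g; Cod C k = Dom C f'; Cod C f' = Dom C g'\<rbrakk>
    \<Longrightarrow> g \<cdot> (f \<cdot> k) = g' \<cdot> (f' \<cdot> k)"
  by (metis comp_assoc)

lemma comp_cancel:
  "\<lbrakk>g \<cdot> f = Id C A; k \<in> Arr C; f \<in> Arr C; g \<in> Arr C;
    Cod C k = Dom C f; Cod C f = Dom C g; Cod C k = A\<rbrakk>
    \<Longrightarrow> g \<cdot> (f \<cdot> k) = k"
  by (metis comp_assoc comp_id_left)

lemma inverse_arrows_sym: "inverse_arrows C f g \<Longrightarrow> inverse_arrows C g f"
  by (auto simp: inverse_arrows_def Hom_def)

lemma inverse_arrows_unique:
  assumes "inverse_arrows C f g" "inverse_arrows C f g'"
  shows "g = g'"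
proof -
  have "g = (g' \<cdot> f) \<cdot> g"
    using assms by (simp add: inverse_arrows_def Hom_def)
  also have "\<dots> = g' \<cdot> (f \<cdot> g)"
    using assms by (intro comp_assoc) (auto simp: inverse_arrows_def Hom_def)
  also have "\<dots> = g'"
    using assms by (simp add: inverse_arrows_def Hom_def)
  finally show ?thesis .
qed

lemma inv_arr_eqI: "inverse_arrows C f g \<Longrightarrow> inv_arr C f = g"
  unfolding inv_arr_def using inverse_arrows_unique by blast

lemma is_iso_id [simp]: "A \<in> Obj C \<Longrightarrow> is_iso C (Id C A)"
  unfolding is_iso_def by (rule exI[of _ "Id C A"]) (simp add: inverse_arrows_def Hom_def)

lemma is_iso_comp:
  assumes "is_iso C f" "is_iso C g" "Cod C f = Dom C g"
  shows "is_iso C (g \<cdot> f)"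
proof -
  from assms obtain f' g' where f': "inverse_arrows C f f'" and g': "inverse_arrows C g g'"
    by (auto simp: is_iso_def)
  have *: "f \<in> Arr C" "g \<in> Arr C" "f' \<in> Arr C" "g' \<in> Arr C" "Dom C f' = Cod C f"
    "Cod C f' = Dom C f" "Dom C g' = Cod C g" "Cod C g' = Dom C g"
    "f' \<cdot> f = Id C (Dom C f)" "f \<cdot> f' = Id C (Cod C f)"
    "g' \<cdot> g = Id C (Dom C g)" "g \<cdot> g' = Id C (Cod C g)"
    using f' g' by (auto simp: inverse_arrows_def Hom_def)
  have "inverse_arrows C (g \<cdot> f) (f' \<cdot> g')"
    using * assms(3) comp_cancel[of g' g _ f] comp_cancel[of f f' _ g']
    by (simp add: inverse_arrows_def Hom_def)
  then show ?thesis
    by (auto simp: is_iso_def)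
qed

end

context cat_functor
begin

lemma omap_Obj [simp]: "A \<in> Obj C \<Longrightarrow> omap F A \<in> Obj D"
  by (rule omap_in_Obj)

lemma amap_arr [simp]:
  assumes "f \<in> Arr C"
  shows "amap F f \<in> Arr D" "Dom D (amap F f) = omap F (Dom C f)"
    "Cod D (amap F f) = omap F (Cod C f)"
  using amap_in_Hom[of f "Dom C f" "Cod C f"] assms by (auto simp: Hom_def)

lemma amap_Id [simp]: "A \<in> Obj C \<Longrightarrow> amap F (Id C A) = Id D (omap F A)"
  by (rule amap_id)

lemma amap_Comp [simp]:
  "\<lbrakk>f \<in> Arr C; g \<in> Arr C; Cod C f = Dom C g\<rbrakk>
    \<Longrightarrow> amap F (g \<cdot>\<^bsub>C\<^esub> f) = amap F g \<cdot>\<^bsub>D\<^esub> amap F f"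
  using amap_comp[of f "Dom C f" "Dom C g" g "Cod C g"] by (auto simp: Hom_def)

lemma amap_inverse_arrows:
  assumes "inverse_arrows C f g"
  shows "inverse_arrows D (amap F f) (amap F g)"
proof -
  have *: "f \<in> Arr C" "g \<in> Arr C" "Dom C g = Cod C f" "Cod C g = Dom C f"
    "g \<cdot>\<^bsub>C\<^esub> f = Id C (Dom C f)" "f \<cdot>\<^bsub>C\<^esub> g = Id C (Cod C f)"
    using assms by (auto simp: inverse_arrows_def Hom_def)
  show ?thesis
    using * amap_Comp[of f g] amap_Comp[of g f] by (simp add: inverse_arrows_def Hom_def)
qed

end

lemma func_comp_simps [simp]:
  "omap (G \<circ>\<^sub>F F) A = omap G (omap F A)" "amap (G \<circ>\<^sub>F F) f = amap G (amap F f)"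
  by (simp_all add: func_comp_def)

lemma cat_functor_comp:
  assumes "cat_functor C D F" "cat_functor D E G"
  shows "cat_functor C E (G \<circ>\<^sub>F F)"
proof -
  interpret F: cat_functor C D F by fact
  interpret G: cat_functor D E G by fact
  show ?thesis
    by unfold_locales (auto simp: Hom_def)
qed

lemma (in fully_faithful_functor) faithful:
  assumes "f \<in> Arr C" "g \<in> Arr C" "Dom C f = Dom C g" "Cod C f = Cod C g"
    "amap F f = amap F g"
  shows "f = g"
proof -
  have "inj_on (amap F) (Hom C (Dom C f) (Cod C f))"
    using amap_bij[of "Dom C f" "Cod C f"] assms(1) by (simp add: bij_betw_def)
  then show ?thesis
    using assms by (auto simp: inj_on_def Hom_def)
qed

lemma (in fully_faithful_functor) full:
  assumes "A \<in> Obj C" "B \<in> Obj C" "u \<in> Arr D" "Dom D u = omap F A" "Cod D u = omap F B"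
  obtains f where "f \<in> Arr C" "Dom C f = A" "Cod C f = B" "amap F f = u"
proof -
  have "u \<in> amap F ` Hom C A B"
    using amap_bij[of A B] assms by (auto simp: bij_betw_def Hom_def)
  then show ?thesis
    using that by (auto simp: Hom_def)
qed

section \<open>Adjunctions\<close>

context adjunction
begin

lemma unit_arr [simp]:
  assumes "A \<in> Obj C"
  shows "\<eta> A \<in> Arr C" "Dom C (\<eta> A) = A" "Cod C (\<eta> A) = omap R (omap L A)"
  using unit_in_Hom[OF assms] by (auto simp: Hom_def)

lemma counit_arr [simp]:
  assumes "U \<in> Obj D"
  shows "\<epsilon> U \<in> Arr D" "Dom D (\<epsilon> U) = omap L (omap R U)" "Cod D (\<epsilon> U) = U"
  using counit_in_Hom[OF assms] by (auto simp: Hom_def)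

lemma unit_nat: "f \<in> Arr C \<Longrightarrow> \<eta> (Cod C f) \<cdot>\<^bsub>C\<^esub> f = amap R (amap L f) \<cdot>\<^bsub>C\<^esub> \<eta> (Dom C f)"
  using unit_natural[of f] by (simp add: Hom_def)

lemma counit_nat: "g \<in> Arr D \<Longrightarrow> \<epsilon> (Cod D g) \<cdot>\<^bsub>D\<^esub> amap L (amap R g) = g \<cdot>\<^bsub>D\<^esub> \<epsilon> (Dom D g)"
  using counit_natural[of g] by (simp add: Hom_def)

lemma transpose_left:
  assumes "A \<in> Obj C" "u \<in> Arr D" "Dom D u = omap L A"
  shows "\<epsilon> (Cod D u) \<cdot>\<^bsub>D\<^esub> amap L (amap R u \<cdot>\<^bsub>C\<^esub> \<eta> A) = u"
proof -
  have "\<epsilon> (Cod D u) \<cdot>\<^bsub>D\<^esub> amap L (amap R u \<cdot>\<^bsub>C\<^esub> \<eta> A)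
      = (\<epsilon> (Cod D u) \<cdot>\<^bsub>D\<^esub> amap L (amap R u)) \<cdot>\<^bsub>D\<^esub> amap L (\<eta> A)"
    using assms by simp
  also have "\<dots> = u"
    unfolding counit_nat[OF assms(2)] using assms triangle_L by simp
  finally show ?thesis .
qed

lemma transpose_right:
  assumes "U \<in> Obj D" "u \<in> Arr C" "Cod C u = omap R U"
  shows "amap R (\<epsilon> U \<cdot>\<^bsub>D\<^esub> amap L u) \<cdot>\<^bsub>C\<^esub> \<eta> (Dom C u) = u"
proof -
  have "amap R (\<epsilon> U \<cdot>\<^bsub>D\<^esub> amap L u) \<cdot>\<^bsub>C\<^esub> \<eta> (Dom C u) = amap R (\<epsilon> U) \<cdot>\<^bsub>C\<^esub> (\<eta> (omap R U) \<cdot>\<^bsub>C\<^esub> u)"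
    using assms unit_nat[of u] by simp
  also have "\<dots> = u"
    using assms triangle_R by (intro L.C.comp_cancel) auto
  finally show ?thesis .
qed

end

section \<open>Additive categories and additive functors\<close>

context additive_category
begin

lemma zero_arr [simp]:
  assumes "A \<in> Obj C" "B \<in> Obj C"
  shows "Zero C A B \<in> Arr C" "Dom C (Zero C A B) = A" "Cod C (Zero C A B) = B"
proof -
  interpret G: comm_group "hom_group C A B" using assms by (rule hom_group)
  show "Zero C A B \<in> Arr C" "Dom C (Zero C A B) = A" "Cod C (Zero C A B) = B"
    using G.one_closed by (auto simp: hom_group_def Hom_def)
qed

lemma plus_arr [simp]:
  assumes "f \<in> Arr C" "g \<in> Arr C" "Dom C f = Dom C g" "Cod C f = Cod C g"
  shows "f \<oplus> g \<in> Arr C" "Dom C (f \<oplus> g) = Dom C g" "Cod C (f \<oplus> g) = Cod C g"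
proof -
  interpret G: comm_group "hom_group C (Dom C f) (Cod C f)" using assms by (simp add: hom_group)
  show "f \<oplus> g \<in> Arr C" "Dom C (f \<oplus> g) = Dom C g" "Cod C (f \<oplus> g) = Cod C g"
    using G.m_closed[of f g] assms by (auto simp: hom_group_def Hom_def)
qed

lemma comp_plus:
  assumes "f \<in> Arr C" "g \<in> Arr C" "Dom C f = Dom C g" "Cod C f = Cod C g"
  shows "\<lbrakk>k \<in> Arr C; Cod C k = Dom C f\<rbrakk> \<Longrightarrow> (f \<oplus> g) \<cdot> k = (f \<cdot> k) \<oplus> (g \<cdot> k)"
    "\<lbrakk>k \<in> Arr C; Dom C k = Cod C f\<rbrakk> \<Longrightarrow> k \<cdot> (f \<oplus> g) = (k \<cdot> f) \<oplus> (k \<cdot> g)"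
  using assms comp_plus_left[of k "Dom C k" "Dom C f" f "Cod C f" g]
    comp_plus_right[of f "Dom C f" "Cod C f" g k "Cod C k"] by (auto simp: Hom_def)

lemma plus_zero [simp]:
  assumes "f \<in> Arr C" "Dom C f = A" "Cod C f = B"
  shows "f \<oplus> Zero C A B = f" "Zero C A B \<oplus> f = f"
proof -
  interpret G: comm_group "hom_group C A B" using assms by (auto intro: hom_group)
  show "f \<oplus> Zero C A B = f" "Zero C A B \<oplus> f = f"
    using G.r_one[of f] G.l_one[of f] assms by (auto simp: hom_group_def Hom_def)
qed

lemma plus_self_zero:
  assumes "f \<in> Arr C" "f \<oplus> f = f"
  shows "f = Zero C (Dom C f) (Cod C f)"
proof -
  interpret G: comm_group "hom_group C (Dom C f) (Cod C f)" using assms by (auto intro: hom_group)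
  show ?thesis
    using G.l_cancel_one[of f f] assms by (auto simp: hom_group_def Hom_def)
qed

lemma comp_zero [simp]:
  assumes "A \<in> Obj C" "B \<in> Obj C" "f \<in> Arr C"
  shows "Dom C f = B \<Longrightarrow> f \<cdot> Zero C A B = Zero C A (Cod C f)"
    "Cod C f = A \<Longrightarrow> Zero C A B \<cdot> f = Zero C (Dom C f) B"
proof -
  show "f \<cdot> Zero C A B = Zero C A (Cod C f)" if "Dom C f = B"
    using plus_self_zero[of "f \<cdot> Zero C A B"] comp_plus(2)[of "Zero C A B" "Zero C A B" f]
      that assms by simp
  show "Zero C A B \<cdot> f = Zero C (Dom C f) B" if "Cod C f = A"
    using plus_self_zero[of "Zero C A B \<cdot> f"] comp_plus(1)[of "Zero C A B" "Zero C A B" f]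
      that assms by simp
qed

lemma neg_eqI:
  assumes "f \<in> Arr C" "g \<in> Arr C" "Dom C g = Dom C f" "Cod C g = Cod C f"
    "g \<oplus> f = Zero C (Dom C f) (Cod C f)"
  shows "neg C f = g"
proof -
  interpret G: comm_group "hom_group C (Dom C f) (Cod C f)" using assms by (auto intro: hom_group)
  show ?thesis
    unfolding neg_def by (rule G.inv_equality) (use assms in \<open>auto simp: hom_group_def Hom_def\<close>)
qed

lemma neg_arr [simp]:
  assumes "f \<in> Arr C"
  shows "neg C f \<in> Arr C" "Dom C (neg C f) = Dom C f" "Cod C (neg C f) = Cod C f"
    "neg C f \<oplus> f = Zero C (Dom C f) (Cod C f)"
proof -
  interpret G: comm_group "hom_group C (Dom C f) (Cod C f)" using assms by (auto intro: hom_group)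
  show "neg C f \<in> Arr C" "Dom C (neg C f) = Dom C f" "Cod C (neg C f) = Cod C f"
    "neg C f \<oplus> f = Zero C (Dom C f) (Cod C f)"
    using G.inv_closed[of f] G.l_inv[of f] assms
    unfolding neg_def by (auto simp: hom_group_def Hom_def)
qed

lemma zero_object_iff: "zero_object C Z \<longleftrightarrow> Z \<in> Obj C \<and> Id C Z = Zero C Z Z"
proof (intro iffI conjI; (elim conjE)?)
  assume "zero_object C Z"
  then show Z: "Z \<in> Obj C" by (simp add: zero_object_def)
  then show "Id C Z = Zero C Z Z"
    using \<open>zero_object C Z\<close> zero_arr[OF Z Z] id_arr[OF Z] by (auto simp: zero_object_def Hom_def)
next
  assume Z: "Z \<in> Obj C" and id: "Id C Z = Zero C Z Z"
  have "\<exists>!f. f \<in> Hom C Z A" if "A \<in> Obj C" for A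
  proof (rule ex1I[of _ "Zero C Z A"])
    fix f assume "f \<in> Hom C Z A"
    then have "f \<in> Arr C" "Dom C f = Z" "Cod C f = A" by (auto simp: Hom_def)
    then show "f = Zero C Z A"
      using comp_id_right[of f Z] Z by (simp add: id)
  qed (use Z that in \<open>simp add: Hom_def\<close>)
  moreover have "\<exists>!f. f \<in> Hom C A Z" if "A \<in> Obj C" for A
  proof (rule ex1I[of _ "Zero C A Z"])
    fix f assume "f \<in> Hom C A Z"
    then have "f \<in> Arr C" "Dom C f = A" "Cod C f = Z" by (auto simp: Hom_def)
    then show "f = Zero C A Z"
      using comp_id_left[of f Z] Z by (simp add: id)
  qed (use Z that in \<open>simp add: Hom_def\<close>)
  ultimately show "zero_object C Z"
    using Z by (simp add: zero_object_def)
qed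

end

context additive_functor
begin

lemma amap_plus:
  assumes "f \<in> Arr C" "g \<in> Arr C" "Dom C f = Dom C g" "Cod C f = Cod C g"
  shows "amap F (f \<oplus>\<^bsub>C\<^esub> g) = amap F f \<oplus>\<^bsub>D\<^esub> amap F g"
  using amap_hom[of "Dom C f" "Cod C f"] assms by (auto simp: hom_def hom_group_def Hom_def)

lemma amap_zero [simp]:
  assumes "A \<in> Obj C" "B \<in> Obj C"
  shows "amap F (Zero C A B) = Zero D (omap F A) (omap F B)"
  using D.plus_self_zero[of "amap F (Zero C A B)"]
    amap_plus[of "Zero C A B" "Zero C A B"] assms by simp

lemma amap_neg [simp]: "f \<in> Arr C \<Longrightarrow> amap F (neg C f) = neg D (amap F f)"
  by (intro D.neg_eqI[THEN sym]) (simp_all add: amap_plus[THEN sym])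

lemma amap_zero_object: "zero_object C Z \<Longrightarrow> zero_object D (omap F Z)"
  unfolding C.zero_object_iff D.zero_object_iff using amap_Id[of Z] by auto

end

lemma additive_functorI:
  assumes "additive_category C" "additive_category D" "cat_functor C D F"
    and "\<And>f g. \<lbrakk>f \<in> Arr C; g \<in> Arr C; Dom C f = Dom C g; Cod C f = Cod C g\<rbrakk>
      \<Longrightarrow> amap F (f \<oplus>\<^bsub>C\<^esub> g) = amap F f \<oplus>\<^bsub>D\<^esub> amap F g"
  shows "additive_functor C D F"
proof -
  interpret F: cat_functor C D F by fact
  show ?thesis
    using assms
    by (intro additive_functor.intro additive_functor_axioms.intro)
      (auto simp: hom_def hom_group_def Hom_def)
qed

lemma additive_functor_comp:
  assumes "additive_functor C D F" "additive_functor D E G"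
  shows "additive_functor C E (G \<circ>\<^sub>F F)"
proof -
  interpret F: additive_functor C D F by fact
  interpret G: additive_functor D E G by fact
  show ?thesis
    by (intro additive_functorI cat_functor_comp[where D = D])
      (unfold_locales, simp_all add: F.amap_plus G.amap_plus)
qed

text \<open>
  A left adjoint \<open>L\<close> preserves initial objects and jointly epic families, hence carries zero
  arrows to zero arrows and a biproduct diagram to a biproduct diagram; the sum \<open>f + g\<close> is
  \<open>(f p\<^sub>1 + g p\<^sub>2) (i\<^sub>1 + i\<^sub>2)\<close> for a biproduct of the common domain with itself.
\<close>

theorem left_adjoint_additive:
  assumes "additive_category C" "additive_category D" "adjunction C D L R \<eta> \<epsilon>"
  shows "additive_functor C D L"
proof -
  interpret C: additive_category C by fact
  interpret D: additive_category D by fact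
  interpret adjunction C D L R \<eta> \<epsilon> by fact
  have L_zero: "amap L (Zero C A B) = Zero D (omap L A) (omap L B)"
    if AB: "A \<in> Obj C" "B \<in> Obj C" for A B
  proof -
    obtain Z where Z: "zero_object C Z" using C.has_zero_object by blast
    then have ZO: "Z \<in> Obj C" by (simp add: zero_object_def)
    let ?O = "omap L Z"
    have "\<exists>!f. f \<in> Hom C Z (omap R ?O)"
      using Z ZO by (simp add: zero_object_def)
    then have "amap R (Id D ?O) \<cdot>\<^bsub>C\<^esub> \<eta> Z = amap R (Zero D ?O ?O) \<cdot>\<^bsub>C\<^esub> \<eta> Z"
      using ZO by (auto simp: Hom_def)
    then have id: "Id D ?O = Zero D ?O ?O"
      using transpose_left[of Z "Id D ?O"] transpose_left[of Z "Zero D ?O ?O"] ZO by simp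
    have "Zero C A B = Zero C Z B \<cdot>\<^bsub>C\<^esub> Zero C A Z"
      using AB ZO by simp
    then have "amap L (Zero C A B)
        = amap L (Zero C Z B) \<cdot>\<^bsub>D\<^esub> (Id D ?O \<cdot>\<^bsub>D\<^esub> amap L (Zero C A Z))"
      using AB ZO by (simp del: C.comp_zero)
    then show ?thesis
      using AB ZO by (simp del: D.comp_id_left add: id)
  qed
  show ?thesis
  proof (rule additive_functorI)
    fix f g
    assume fg: "f \<in> Arr C" "g \<in> Arr C" "Dom C f = Dom C g" "Cod C f = Cod C g"
    let ?A = "Dom C g"
    have A: "?A \<in> Obj C" using fg by simp
    obtain P i\<^sub>1 i\<^sub>2 p\<^sub>1 p\<^sub>2 where "i\<^sub>1 \<in> Hom C ?A P \<and> i\<^sub>2 \<in> Hom C ?A P \<and> p\<^sub>1 \<in> Hom C P ?A \<and> p\<^sub>2 \<in> Hom C P ?A \<and>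
            p\<^sub>1 \<cdot>\<^bsub>C\<^esub> i\<^sub>1 = Id C ?A \<and> p\<^sub>2 \<cdot>\<^bsub>C\<^esub> i\<^sub>2 = Id C ?A \<and>
            p\<^sub>2 \<cdot>\<^bsub>C\<^esub> i\<^sub>1 = Zero C ?A ?A \<and> p\<^sub>1 \<cdot>\<^bsub>C\<^esub> i\<^sub>2 = Zero C ?A ?A \<and>
            (i\<^sub>1 \<cdot>\<^bsub>C\<^esub> p\<^sub>1) \<oplus>\<^bsub>C\<^esub> (i\<^sub>2 \<cdot>\<^bsub>C\<^esub> p\<^sub>2) = Id C P"
      using C.has_biproducts[OF A A] by blast
    then have arr [simp]: "i\<^sub>1 \<in> Arr C" "i\<^sub>2 \<in> Arr C" "p\<^sub>1 \<in> Arr C" "p\<^sub>2 \<in> Arr C"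
      "Dom C i\<^sub>1 = ?A" "Dom C i\<^sub>2 = ?A" "Cod C p\<^sub>1 = ?A" "Cod C p\<^sub>2 = ?A"
      "Cod C i\<^sub>1 = P" "Cod C i\<^sub>2 = P" "Dom C p\<^sub>1 = P" "Dom C p\<^sub>2 = P"
      and bip: "p\<^sub>1 \<cdot>\<^bsub>C\<^esub> i\<^sub>1 = Id C ?A" "p\<^sub>2 \<cdot>\<^bsub>C\<^esub> i\<^sub>2 = Id C ?A"
      "p\<^sub>2 \<cdot>\<^bsub>C\<^esub> i\<^sub>1 = Zero C ?A ?A" "p\<^sub>1 \<cdot>\<^bsub>C\<^esub> i\<^sub>2 = Zero C ?A ?A"
      "(i\<^sub>1 \<cdot>\<^bsub>C\<^esub> p\<^sub>1) \<oplus>\<^bsub>C\<^esub> (i\<^sub>2 \<cdot>\<^bsub>C\<^esub> p\<^sub>2) = Id C P"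
      by (auto simp: Hom_def)
    have P [simp]: "P \<in> Obj C" using C.cod_Obj[of i\<^sub>1] by simp
    \<comment> \<open>An arrow \<open>u\<close> out of \<open>L P\<close> is determined by its restrictions along \<open>L i\<^sub>1\<close> and \<open>L i\<^sub>2\<close>, since
      its transpose is \<open>R(u L i\<^sub>1) \<eta> p\<^sub>1 + R(u L i\<^sub>2) \<eta> p\<^sub>2\<close>.\<close>
    have jointly_epic: "u = v" if uv: "u \<in> Arr D" "v \<in> Arr D" "Dom D u = omap L P"
      "Dom D v = omap L P" "Cod D u = Cod D v"
      "u \<cdot>\<^bsub>D\<^esub> amap L i\<^sub>1 = v \<cdot>\<^bsub>D\<^esub> amap L i\<^sub>1" "u \<cdot>\<^bsub>D\<^esub> amap L i\<^sub>2 = v \<cdot>\<^bsub>D\<^esub> amap L i\<^sub>2" for u v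
    proof -
      have tr: "amap R w \<cdot>\<^bsub>C\<^esub> \<eta> P
          = ((amap R (w \<cdot>\<^bsub>D\<^esub> amap L i\<^sub>1) \<cdot>\<^bsub>C\<^esub> \<eta> ?A) \<cdot>\<^bsub>C\<^esub> p\<^sub>1) \<oplus>\<^bsub>C\<^esub> ((amap R (w \<cdot>\<^bsub>D\<^esub> amap L i\<^sub>2) \<cdot>\<^bsub>C\<^esub> \<eta> ?A) \<cdot>\<^bsub>C\<^esub> p\<^sub>2)"
        if w: "w \<in> Arr D" "Dom D w = omap L P" for w
      proof -
        have "(amap R (w \<cdot>\<^bsub>D\<^esub> amap L k) \<cdot>\<^bsub>C\<^esub> \<eta> ?A) = (amap R w \<cdot>\<^bsub>C\<^esub> \<eta> P) \<cdot>\<^bsub>C\<^esub> k"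
          if "k \<in> Arr C" "Dom C k = ?A" "Cod C k = P" for k
          using that w unit_nat[of k] A by simp
        then have "((amap R (w \<cdot>\<^bsub>D\<^esub> amap L i\<^sub>1) \<cdot>\<^bsub>C\<^esub> \<eta> ?A) \<cdot>\<^bsub>C\<^esub> p\<^sub>1) \<oplus>\<^bsub>C\<^esub> ((amap R (w \<cdot>\<^bsub>D\<^esub> amap L i\<^sub>2) \<cdot>\<^bsub>C\<^esub> \<eta> ?A) \<cdot>\<^bsub>C\<^esub> p\<^sub>2)
          = ((amap R w \<cdot>\<^bsub>C\<^esub> \<eta> P) \<cdot>\<^bsub>C\<^esub> (i\<^sub>1 \<cdot>\<^bsub>C\<^esub> p\<^sub>1)) \<oplus>\<^bsub>C\<^esub> ((amap R w \<cdot>\<^bsub>C\<^esub> \<eta> P) \<cdot>\<^bsub>C\<^esub> (i\<^sub>2 \<cdot>\<^bsub>C\<^esub> p\<^sub>2))"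
          using w A by simp
        also have "\<dots> = (amap R w \<cdot>\<^bsub>C\<^esub> \<eta> P) \<cdot>\<^bsub>C\<^esub> ((i\<^sub>1 \<cdot>\<^bsub>C\<^esub> p\<^sub>1) \<oplus>\<^bsub>C\<^esub> (i\<^sub>2 \<cdot>\<^bsub>C\<^esub> p\<^sub>2))"
          using w by (intro C.comp_plus(2)[symmetric]) auto
        finally show ?thesis
          using w by (simp add: bip)
      qed
      have "amap R u \<cdot>\<^bsub>C\<^esub> \<eta> P = amap R v \<cdot>\<^bsub>C\<^esub> \<eta> P"
        unfolding tr[OF uv(1,3)] tr[OF uv(2,4)] uv(6,7) ..
      then show ?thesis
        using transpose_left[of P u] transpose_left[of P v] uv by simp
    qed
    have L_bip: "amap L p\<^sub>1 \<cdot>\<^bsub>D\<^esub> amap L i\<^sub>1 = Id D (omap L ?A)"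
      "amap L p\<^sub>2 \<cdot>\<^bsub>D\<^esub> amap L i\<^sub>2 = Id D (omap L ?A)"
      "amap L p\<^sub>2 \<cdot>\<^bsub>D\<^esub> amap L i\<^sub>1 = Zero D (omap L ?A) (omap L ?A)"
      "amap L p\<^sub>1 \<cdot>\<^bsub>D\<^esub> amap L i\<^sub>2 = Zero D (omap L ?A) (omap L ?A)"
      using A bip L_zero[of ?A ?A] L.amap_Comp[of i\<^sub>1 p\<^sub>1] L.amap_Comp[of i\<^sub>2 p\<^sub>2]
        L.amap_Comp[of i\<^sub>1 p\<^sub>2] L.amap_Comp[of i\<^sub>2 p\<^sub>1] by simp_all
    let ?e = "(amap L i\<^sub>1 \<cdot>\<^bsub>D\<^esub> amap L p\<^sub>1) \<oplus>\<^bsub>D\<^esub> (amap L i\<^sub>2 \<cdot>\<^bsub>D\<^esub> amap L p\<^sub>2)"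
    have e: "?e = Id D (omap L P)"
      by (rule jointly_epic) (use A in \<open>simp_all add: D.comp_plus L_bip\<close>)
    let ?u = "(f \<cdot>\<^bsub>C\<^esub> p\<^sub>1) \<oplus>\<^bsub>C\<^esub> (g \<cdot>\<^bsub>C\<^esub> p\<^sub>2)" and ?d = "i\<^sub>1 \<oplus>\<^bsub>C\<^esub> i\<^sub>2"
    have ui: "?u \<cdot>\<^bsub>C\<^esub> i\<^sub>1 = f" "?u \<cdot>\<^bsub>C\<^esub> i\<^sub>2 = g" and pd: "p\<^sub>1 \<cdot>\<^bsub>C\<^esub> ?d = Id C ?A" "p\<^sub>2 \<cdot>\<^bsub>C\<^esub> ?d = Id C ?A"
      using fg A by (simp_all add: C.comp_plus bip)
    have "f \<oplus>\<^bsub>C\<^esub> g = ?u \<cdot>\<^bsub>C\<^esub> ?d"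
      using fg by (simp add: C.comp_plus(2) ui del: C.comp_assoc)
    then have "amap L (f \<oplus>\<^bsub>C\<^esub> g) = amap L ?u \<cdot>\<^bsub>D\<^esub> (?e \<cdot>\<^bsub>D\<^esub> amap L ?d)"
      unfolding e using fg by simp
    also have "\<dots> = (amap L (?u \<cdot>\<^bsub>C\<^esub> i\<^sub>1) \<cdot>\<^bsub>D\<^esub> amap L (p\<^sub>1 \<cdot>\<^bsub>C\<^esub> ?d)) \<oplus>\<^bsub>D\<^esub> (amap L (?u \<cdot>\<^bsub>C\<^esub> i\<^sub>2) \<cdot>\<^bsub>D\<^esub> amap L (p\<^sub>2 \<cdot>\<^bsub>C\<^esub> ?d))"
      using fg by (simp add: D.comp_plus)
    also have "\<dots> = amap L f \<oplus>\<^bsub>D\<^esub> amap L g"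
      unfolding ui pd using fg by simp
    finally show "amap L (f \<oplus>\<^bsub>C\<^esub> g) = amap L f \<oplus>\<^bsub>D\<^esub> amap L g" .
  qed (unfold_locales)
qed

text \<open>
  Transposition \<open>u \<mapsto> \<epsilon> L(u)\<close> is injective, and it is additive because \<open>L\<close> is;
  \<open>R(f) + R(g)\<close> and \<open>R(f + g)\<close> have the same transpose by naturality of the counit.
\<close>

theorem right_adjoint_additive:
  assumes "additive_category C" "additive_category D" "adjunction C D L R \<eta> \<epsilon>"
  shows "additive_functor D C R"
proof -
  interpret adjunction C D L R \<eta> \<epsilon> by fact
  interpret L: additive_functor C D L using assms by (rule left_adjoint_additive)
  show ?thesis
  proof (rule additive_functorI)
    fix f g
    assume fg: "f \<in> Arr D" "g \<in> Arr D" "Dom D f = Dom D g" "Cod D f = Cod D g"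
    let ?\<epsilon> = "\<epsilon> (Cod D g)"
    have "?\<epsilon> \<cdot>\<^bsub>D\<^esub> amap L (amap R (f \<oplus>\<^bsub>D\<^esub> g)) = (f \<oplus>\<^bsub>D\<^esub> g) \<cdot>\<^bsub>D\<^esub> \<epsilon> (Dom D g)"
      using fg counit_nat[of "f \<oplus>\<^bsub>D\<^esub> g"] by simp
    also have "\<dots> = ?\<epsilon> \<cdot>\<^bsub>D\<^esub> amap L (amap R f \<oplus>\<^bsub>C\<^esub> amap R g)"
      using fg counit_nat[of f] counit_nat[of g] by (simp add: L.D.comp_plus L.amap_plus)
    finally have "?\<epsilon> \<cdot>\<^bsub>D\<^esub> amap L (amap R (f \<oplus>\<^bsub>D\<^esub> g)) = ?\<epsilon> \<cdot>\<^bsub>D\<^esub> amap L (amap R f \<oplus>\<^bsub>C\<^esub> amap R g)" .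
    then show "amap R (f \<oplus>\<^bsub>D\<^esub> g) = amap R f \<oplus>\<^bsub>C\<^esub> amap R g"
      using fg transpose_right[of "Cod D g" "amap R (f \<oplus>\<^bsub>D\<^esub> g)"]
        transpose_right[of "Cod D g" "amap R f \<oplus>\<^bsub>C\<^esub> amap R g"] by simp
  qed (unfold_locales)
qed

section \<open>Isomorphisms of left triangles\<close>

lemma (in category) square_inverse:
  assumes "\<beta> \<cdot> g = g' \<cdot> \<gamma>" "inverse_arrows C \<beta> \<beta>'" "inverse_arrows C \<gamma> \<gamma>'"
    and "g \<in> Arr C" "g' \<in> Arr C" "Cod C g = Dom C \<beta>" "Dom C g = Dom C \<gamma>"
      "Dom C g' = Cod C \<gamma>" "Cod C g' = Cod C \<beta>"
  shows "\<beta>' \<cdot> g' = g \<cdot> \<gamma>'"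
proof -
  have *: "\<beta> \<in> Arr C" "\<beta>' \<in> Arr C" "Dom C \<beta>' = Cod C \<beta>" "Cod C \<beta>' = Dom C \<beta>"
    "\<gamma> \<in> Arr C" "\<gamma>' \<in> Arr C" "Dom C \<gamma>' = Cod C \<gamma>" "Cod C \<gamma>' = Dom C \<gamma>"
    "\<beta>' \<cdot> \<beta> = Id C (Dom C \<beta>)" "\<gamma> \<cdot> \<gamma>' = Id C (Cod C \<gamma>)"
    using assms(2,3) by (auto simp: inverse_arrows_def Hom_def)
  have "\<beta>' \<cdot> g' = \<beta>' \<cdot> ((g' \<cdot> \<gamma>) \<cdot> \<gamma>')"
    using * assms(4-) by simp
  also have "\<dots> = \<beta>' \<cdot> ((\<beta> \<cdot> g) \<cdot> \<gamma>')"
    by (simp only: assms(1))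
  also have "\<dots> = (\<beta>' \<cdot> \<beta>) \<cdot> (g \<cdot> \<gamma>')"
    using *(1-8) assms(4-) by simp
  also have "\<dots> = g \<cdot> \<gamma>'"
    using * assms(4-) by simp
  finally show ?thesis .
qed

lemma left_triangle_isomorphic_sym:
  assumes "cat_functor C C \<Omega>" "left_triangle_isomorphic C \<Omega> T T'"
  shows "left_triangle_isomorphic C \<Omega> T' T"
proof -
  interpret \<Omega>: cat_functor C C \<Omega> by fact
  obtain h g f h' g' f' where T: "T = (h, g, f)" "T' = (h', g', f')"
    by (cases T, cases T')
  obtain \<gamma> \<beta> \<alpha> \<gamma>' \<beta>' \<alpha>' where mor: "left_triangle_morphism C \<Omega> T T' (\<gamma>, \<beta>, \<alpha>)"
    and inv: "inverse_arrows C \<gamma> \<gamma>'" "inverse_arrows C \<beta> \<beta>'" "inverse_arrows C \<alpha> \<alpha>'"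
    using assms(2) unfolding left_triangle_isomorphic_def is_iso_def by blast
  have arr: "\<gamma>' \<in> Hom C (Cod C \<gamma>) (Dom C \<gamma>)" "\<beta>' \<in> Hom C (Cod C \<beta>) (Dom C \<beta>)"
    "\<alpha>' \<in> Hom C (Cod C \<alpha>) (Dom C \<alpha>)"
    using inv by (auto simp: inverse_arrows_def)
  have "\<gamma>' \<cdot>\<^bsub>C\<^esub> h' = h \<cdot>\<^bsub>C\<^esub> amap \<Omega> \<alpha>'"
    by (rule \<Omega>.C.square_inverse[OF _ inv(1) \<Omega>.amap_inverse_arrows[OF inv(3)]])
      (use mor in \<open>auto simp: T Hom_def\<close>)
  moreover have "\<beta>' \<cdot>\<^bsub>C\<^esub> g' = g \<cdot>\<^bsub>C\<^esub> \<gamma>'"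
    by (rule \<Omega>.C.square_inverse[OF _ inv(2) inv(1)]) (use mor in \<open>auto simp: T Hom_def\<close>)
  moreover have "\<alpha>' \<cdot>\<^bsub>C\<^esub> f' = f \<cdot>\<^bsub>C\<^esub> \<beta>'"
    by (rule \<Omega>.C.square_inverse[OF _ inv(3) inv(2)]) (use mor in \<open>auto simp: T Hom_def\<close>)
  ultimately have "left_triangle_morphism C \<Omega> T' T (\<gamma>', \<beta>', \<alpha>')"
    using mor arr by (simp add: T Hom_def)
  moreover have "is_iso C \<gamma>'" "is_iso C \<beta>'" "is_iso C \<alpha>'"
    using inv \<Omega>.C.inverse_arrows_sym unfolding is_iso_def by blast+
  ultimately show ?thesis
    unfolding left_triangle_isomorphic_def by blast
qed

lemma left_triangle_isomorphic_trans:
  assumes "cat_functor C C \<Omega>"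
    and "left_triangle_isomorphic C \<Omega> T T'" "left_triangle_isomorphic C \<Omega> T' T''"
  shows "left_triangle_isomorphic C \<Omega> T T''"
proof -
  interpret \<Omega>: cat_functor C C \<Omega> by fact
  obtain h g f h' g' f' h'' g'' f''
    where T: "T = (h, g, f)" "T' = (h', g', f')" "T'' = (h'', g'', f'')"
    by (cases T, cases T', cases T'')
  obtain \<gamma> \<beta> \<alpha> where 1: "left_triangle_morphism C \<Omega> T T' (\<gamma>, \<beta>, \<alpha>)"
    and iso1: "is_iso C \<gamma>" "is_iso C \<beta>" "is_iso C \<alpha>"
    using assms(2) unfolding left_triangle_isomorphic_def by blast
  obtain \<gamma>' \<beta>' \<alpha>' where 2: "left_triangle_morphism C \<Omega> T' T'' (\<gamma>', \<beta>', \<alpha>')"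
    and iso2: "is_iso C \<gamma>'" "is_iso C \<beta>'" "is_iso C \<alpha>'"
    using assms(3) unfolding left_triangle_isomorphic_def by blast
  note eqs = 1[unfolded T left_triangle_morphism.simps left_triangle.simps Hom_def mem_Collect_eq]
    2[unfolded T left_triangle_morphism.simps left_triangle.simps Hom_def mem_Collect_eq]
  have paste: "(v' \<cdot>\<^bsub>C\<^esub> v) \<cdot>\<^bsub>C\<^esub> x = x'' \<cdot>\<^bsub>C\<^esub> (u' \<cdot>\<^bsub>C\<^esub> u)"
    if "v \<cdot>\<^bsub>C\<^esub> x = x' \<cdot>\<^bsub>C\<^esub> u" "v' \<cdot>\<^bsub>C\<^esub> x' = x'' \<cdot>\<^bsub>C\<^esub> u'"
      "{v, v', x, x', x'', u, u'} \<subseteq> Arr C" "Cod C x = Dom C v" "Cod C v = Dom C v'"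
      "Cod C u = Dom C x'" "Cod C x' = Dom C v'" "Cod C u = Dom C u'" "Cod C u' = Dom C x''"
      "Dom C x = Dom C u"
    for v v' x x' x'' u u'
    using that(3-) by (simp add: that(1) that(2)[symmetric] \<Omega>.C.comp_cong[OF that(2)[symmetric]])
  have "(\<gamma>' \<cdot>\<^bsub>C\<^esub> \<gamma>) \<cdot>\<^bsub>C\<^esub> h = h'' \<cdot>\<^bsub>C\<^esub> amap \<Omega> (\<alpha>' \<cdot>\<^bsub>C\<^esub> \<alpha>)"
    using eqs paste[of \<gamma> h h' "amap \<Omega> \<alpha>" \<gamma>' h'' "amap \<Omega> \<alpha>'"] by simp
  moreover have "(\<beta>' \<cdot>\<^bsub>C\<^esub> \<beta>) \<cdot>\<^bsub>C\<^esub> g = g'' \<cdot>\<^bsub>C\<^esub> (\<gamma>' \<cdot>\<^bsub>C\<^esub> \<gamma>)"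
    using eqs by (intro paste[of _ _ g']) simp_all
  moreover have "(\<alpha>' \<cdot>\<^bsub>C\<^esub> \<alpha>) \<cdot>\<^bsub>C\<^esub> f = f'' \<cdot>\<^bsub>C\<^esub> (\<beta>' \<cdot>\<^bsub>C\<^esub> \<beta>)"
    using eqs by (intro paste[of _ _ f']) simp_all
  ultimately have "left_triangle_morphism C \<Omega> T T'' (\<gamma>' \<cdot>\<^bsub>C\<^esub> \<gamma>, \<beta>' \<cdot>\<^bsub>C\<^esub> \<beta>, \<alpha>' \<cdot>\<^bsub>C\<^esub> \<alpha>)"
    using eqs unfolding T left_triangle_morphism.simps left_triangle.simps Hom_def mem_Collect_eq
    by (simp del: \<Omega>.C.comp_assoc)
  moreover have "is_iso C (\<gamma>' \<cdot>\<^bsub>C\<^esub> \<gamma>)" "is_iso C (\<beta>' \<cdot>\<^bsub>C\<^esub> \<beta>)" "is_iso C (\<alpha>' \<cdot>\<^bsub>C\<^esub> \<alpha>)"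
    using iso1 iso2 eqs by (simp_all add: \<Omega>.C.is_iso_comp)
  ultimately show ?thesis
    unfolding left_triangle_isomorphic_def by blast
qed

section \<open>The left triangulation induced by a coreflection\<close>

text \<open>
  A left coreflective functor into a left triangulated category, with the chosen adjunction.
\<close>

locale coreflection =
  LT: left_triangulated C \<Omega> \<Delta> + X: additive_category X +
  i: fully_faithful_functor X C i + adjunction X C i Q \<eta> \<epsilon>
  for C :: "('o, 'a) acat" and \<Omega> :: "('o, 'a, 'o, 'a) func" and \<Delta> :: "'a triangle set"
    and X :: "('p, 'b) acat" and i :: "('p, 'b, 'o, 'a) func" and Q :: "('o, 'a, 'p, 'b) func"
    and \<eta> :: "'p \<Rightarrow> 'b" and \<epsilon> :: "'o \<Rightarrow> 'a" +
  assumes coreflects: "\<lbrakk>f \<in> Arr C; (h, g, f) \<in> \<Delta>; (h', g', amap i (amap Q f)) \<in> \<Delta>;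
      left_triangle_morphism C \<Omega> (h', g', amap i (amap Q f)) (h, g, f)
        (t, \<epsilon> (Dom C f), \<epsilon> (Cod C f))\<rbrakk> \<Longrightarrow> is_iso X (amap Q t)"
begin

sublocale i: additive_functor X C i
  by (rule left_adjoint_additive[where R = Q and \<eta> = \<eta> and \<epsilon> = \<epsilon>]) unfold_locales

sublocale Q: additive_functor C X Q
  by (rule right_adjoint_additive[where L = i and \<eta> = \<eta> and \<epsilon> = \<epsilon>]) unfold_locales

text \<open>The endofunctor of \<open>X\<close>.\<close>

abbreviation \<Omega>' where "\<Omega>' \<equiv> Q \<circ>\<^sub>F \<Omega> \<circ>\<^sub>F i"

text \<open>The induced triangles of \<open>X\<close>.\<close>

abbreviation \<Delta>' where "\<Delta>' \<equiv> induced_left_triangles \<Omega> \<Delta> X i Q \<eta>"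

sublocale \<Omega>': additive_functor X X \<Omega>'
  by (intro additive_functor_comp[where D = C]) unfold_locales

text \<open>The inverse of the unit.\<close>

abbreviation \<kappa> where "\<kappa> A \<equiv> inv_arr X (\<eta> A)"

lemma unit_inverse:
  assumes A: "A \<in> Obj X"
  shows "inverse_arrows X (\<eta> A) (\<kappa> A)" "amap i (\<kappa> A) = \<epsilon> (omap i A)"
proof -
  obtain s where s [simp]: "s \<in> Arr X" "Dom X s = omap Q (omap i A)" "Cod X s = A"
    and i_s: "amap i s = \<epsilon> (omap i A)"
    using i.full[of "omap Q (omap i A)" A "\<epsilon> (omap i A)"] A by auto
  have "s \<cdot>\<^bsub>X\<^esub> \<eta> A = Id X A"
    by (rule i.faithful) (use A in \<open>simp_all add: i_s triangle_L\<close>)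
  moreover have "\<eta> A \<cdot>\<^bsub>X\<^esub> s = Id X (omap Q (omap i A))"
    using unit_nat[of s] A by (simp add: i_s triangle_R)
  ultimately have inv: "inverse_arrows X (\<eta> A) s"
    using A by (simp add: inverse_arrows_def Hom_def)
  then have "\<kappa> A = s" by (rule X.inv_arr_eqI)
  then show "inverse_arrows X (\<eta> A) (\<kappa> A)" "amap i (\<kappa> A) = \<epsilon> (omap i A)"
    using inv i_s by simp_all
qed

lemma unit_iso [simp]: "A \<in> Obj X \<Longrightarrow> is_iso X (\<eta> A)"
  using unit_inverse(1) by (auto simp: is_iso_def)

lemma \<kappa>_arr [simp]:
  assumes "A \<in> Obj X"
  shows "\<kappa> A \<in> Arr X" "Dom X (\<kappa> A) = omap Q (omap i A)" "Cod X (\<kappa> A) = A"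
    "\<kappa> A \<cdot>\<^bsub>X\<^esub> \<eta> A = Id X A" "\<eta> A \<cdot>\<^bsub>X\<^esub> \<kappa> A = Id X (omap Q (omap i A))"
  using unit_inverse(1)[OF assms] assms by (auto simp: inverse_arrows_def Hom_def)

lemma \<kappa>_nat:
  assumes "f \<in> Arr X"
  shows "\<kappa> (Cod X f) \<cdot>\<^bsub>X\<^esub> amap Q (amap i f) = f \<cdot>\<^bsub>X\<^esub> \<kappa> (Dom X f)"
  by (rule X.square_inverse[OF unit_nat[OF assms]]) (use assms in \<open>simp_all add: unit_inverse\<close>)

text \<open>With the triangle identity for \<open>Q\<close>, \<open>Q \<epsilon>\<^sub>U\<close> is a two-sided inverse of \<open>\<eta>\<close> at \<open>Q U\<close>.\<close>

lemma unit_counit: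
  assumes U: "U \<in> Obj C"
  shows "\<eta> (omap Q U) \<cdot>\<^bsub>X\<^esub> amap Q (\<epsilon> U) = Id X (omap Q (omap i (omap Q U)))"
proof -
  have "amap Q (\<epsilon> U) = (amap Q (\<epsilon> U) \<cdot>\<^bsub>X\<^esub> \<eta> (omap Q U)) \<cdot>\<^bsub>X\<^esub> \<kappa> (omap Q U)"
    using U by simp
  also have "\<dots> = \<kappa> (omap Q U)"
    using U triangle_R by simp
  finally show ?thesis using U by simp
qed

lemma \<Delta>_arr:
  assumes "(h, g, f) \<in> \<Delta>"
  shows "f \<in> Arr C" "g \<in> Arr C" "h \<in> Arr C" "Cod C g = Dom C f" "Cod C h = Dom C g"
    "Dom C h = omap \<Omega> (Cod C f)"
  using LT.left_triangles[OF assms] by auto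

lemma left_triangle_standard:
  assumes "f \<in> Arr X" "(h, g, amap i f) \<in> \<Delta>"
  shows "left_triangle X \<Omega>' (amap Q h, \<kappa> (Dom X f) \<cdot>\<^bsub>X\<^esub> amap Q g, f)"
  using assms(1) \<Delta>_arr[OF assms(2)] by simp

text \<open>
  A triangle of \<open>X\<close> is induced iff it is isomorphic to the image of a triangle of \<open>C\<close> by an
  isomorphism that is the identity on its last two objects; the two lemmas below give the two
  directions.  Composing with the unit avoids its inverse.
\<close>

lemma inducedE:
  assumes "(h, g, f) \<in> \<Delta>'"
  obtains h\<^sub>0 g\<^sub>0 \<gamma> where "left_triangle X \<Omega>' (h, g, f)" "(h\<^sub>0, g\<^sub>0, amap i f) \<in> \<Delta>"
    "is_iso X \<gamma>" "\<gamma> \<in> Arr X" "Dom X \<gamma> = Dom X g" "Cod X \<gamma> = omap Q (Dom C g\<^sub>0)"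
    "\<gamma> \<cdot>\<^bsub>X\<^esub> h = amap Q h\<^sub>0" "\<eta> (Dom X f) \<cdot>\<^bsub>X\<^esub> g = amap Q g\<^sub>0 \<cdot>\<^bsub>X\<^esub> \<gamma>"
proof -
  from assms obtain f' h' g' \<gamma> \<beta> \<alpha> where f': "f' \<in> Arr X" and \<Delta>: "(h', g', amap i f') \<in> \<Delta>"
    and mor: "left_triangle_morphism X \<Omega>' (h, g, f)
      (amap Q h', \<kappa> (Dom X f') \<cdot>\<^bsub>X\<^esub> amap Q g', f') (\<gamma>, \<beta>, \<alpha>)"
    and iso: "is_iso X \<gamma>" "is_iso X \<beta>" "is_iso X \<alpha>"
    unfolding induced_left_triangles_def left_triangle_isomorphic_def by blast
  obtain \<beta>' \<alpha>' where inv: "inverse_arrows X \<beta> \<beta>'" "inverse_arrows X \<alpha> \<alpha>'"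
    using iso by (auto simp: is_iso_def)
  note D [simp] = \<Delta>_arr[OF \<Delta>]
  have [simp]: "f \<in> Arr X" "g \<in> Arr X" "h \<in> Arr X" "Cod X g = Dom X f" "Cod X h = Dom X g"
      "Dom X h = omap \<Omega>' (Cod X f)" "\<gamma> \<in> Arr X" "Dom X \<gamma> = Dom X g" "Cod X \<gamma> = omap Q (Dom C g')"
      "\<beta> \<in> Arr X" "Dom X \<beta> = Dom X f" "Cod X \<beta> = Dom X f'"
      "\<alpha> \<in> Arr X" "Dom X \<alpha> = Cod X f" "Cod X \<alpha> = Cod X f'"
    and eqs: "\<gamma> \<cdot>\<^bsub>X\<^esub> h = amap Q h' \<cdot>\<^bsub>X\<^esub> amap \<Omega>' \<alpha>"
      "\<beta> \<cdot>\<^bsub>X\<^esub> g = (\<kappa> (Dom X f') \<cdot>\<^bsub>X\<^esub> amap Q g') \<cdot>\<^bsub>X\<^esub> \<gamma>" "\<alpha> \<cdot>\<^bsub>X\<^esub> f = f' \<cdot>\<^bsub>X\<^esub> \<beta>"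
    using mor f' by (auto simp: Hom_def)
  have [simp]: "\<beta>' \<in> Arr X" "Dom X \<beta>' = Dom X f'" "Cod X \<beta>' = Dom X f" "\<beta>' \<cdot>\<^bsub>X\<^esub> \<beta> = Id X (Dom X f)"
    "\<alpha>' \<in> Arr X" "Dom X \<alpha>' = Cod X f'" "Cod X \<alpha>' = Cod X f" "\<alpha>' \<cdot>\<^bsub>X\<^esub> \<alpha> = Id X (Cod X f)"
    "\<alpha> \<cdot>\<^bsub>X\<^esub> \<alpha>' = Id X (Cod X f')"
    using inv by (auto simp: inverse_arrows_def Hom_def)
  have i_inv: "is_iso C (amap i \<beta>')" "is_iso C (amap i \<alpha>')"
    using inv X.inverse_arrows_sym i.amap_inverse_arrows unfolding is_iso_def by blast+
  \<comment> \<open>Transport the triangle on \<open>i f'\<close> along \<open>i \<beta>\<close> and \<open>i \<alpha>\<close> to a triangle on \<open>i f\<close>.\<close>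
  let ?h = "h' \<cdot>\<^bsub>C\<^esub> amap \<Omega> (amap i \<alpha>)" and ?g = "amap i \<beta>' \<cdot>\<^bsub>C\<^esub> g'"
  have "\<alpha>' \<cdot>\<^bsub>X\<^esub> f' = f \<cdot>\<^bsub>X\<^esub> \<beta>'"
    by (rule X.square_inverse[OF eqs(3) inv(2,1)]) (use f' in simp_all)
  then have sq: "amap i \<alpha>' \<cdot>\<^bsub>C\<^esub> amap i f' = amap i f \<cdot>\<^bsub>C\<^esub> amap i \<beta>'"
    using f' by (metis (no_types, lifting) i.amap_Comp \<open>\<alpha>' \<in> Arr X\<close> \<open>\<beta>' \<in> Arr X\<close> \<open>f \<in> Arr X\<close>
        \<open>Dom X \<alpha>' = Cod X f'\<close> \<open>Cod X \<beta>' = Dom X f\<close>)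
  have \<Omega>\<alpha>: "amap \<Omega> (amap i \<alpha>) \<cdot>\<^bsub>C\<^esub> amap \<Omega> (amap i \<alpha>') = Id C (omap \<Omega> (omap i (Cod X f')))"
    using LT.amap_inverse_arrows[OF i.amap_inverse_arrows[OF inv(2)]] f'
    by (simp add: inverse_arrows_def)
  have "left_triangle_isomorphic C \<Omega> (h', g', amap i f') (?h, ?g, amap i f)"
    unfolding left_triangle_isomorphic_def
    by (rule exI[of _ "Id C (Dom C g')"], rule exI[of _ "amap i \<beta>'"], rule exI[of _ "amap i \<alpha>'"])
      (use f' D sq \<Omega>\<alpha> i_inv in \<open>simp add: Hom_def\<close>)
  then have "(?h, ?g, amap i f) \<in> \<Delta>"
    using \<Delta> LT.iso_closed by blast
  moreover have "\<gamma> \<cdot>\<^bsub>X\<^esub> h = amap Q ?h"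
    using eqs(1) f' by simp
  moreover have "\<eta> (Dom X f) \<cdot>\<^bsub>X\<^esub> g = amap Q ?g \<cdot>\<^bsub>X\<^esub> \<gamma>"
  proof -
    have "\<eta> (Dom X f) \<cdot>\<^bsub>X\<^esub> g = \<eta> (Dom X f) \<cdot>\<^bsub>X\<^esub> (\<beta>' \<cdot>\<^bsub>X\<^esub> (\<beta> \<cdot>\<^bsub>X\<^esub> g))"
      by (simp add: X.comp_cancel)
    also have "\<dots> = (\<eta> (Dom X f) \<cdot>\<^bsub>X\<^esub> \<beta>') \<cdot>\<^bsub>X\<^esub> (\<kappa> (Dom X f') \<cdot>\<^bsub>X\<^esub> (amap Q g' \<cdot>\<^bsub>X\<^esub> \<gamma>))"
      using f' by (simp add: eqs(2))
    also have "\<eta> (Dom X f) \<cdot>\<^bsub>X\<^esub> \<beta>' = amap Q (amap i \<beta>') \<cdot>\<^bsub>X\<^esub> \<eta> (Dom X f')"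
      using unit_nat[of \<beta>'] by simp
    also have "(amap Q (amap i \<beta>') \<cdot>\<^bsub>X\<^esub> \<eta> (Dom X f')) \<cdot>\<^bsub>X\<^esub> (\<kappa> (Dom X f') \<cdot>\<^bsub>X\<^esub> (amap Q g' \<cdot>\<^bsub>X\<^esub> \<gamma>))
        = amap Q ?g \<cdot>\<^bsub>X\<^esub> \<gamma>"
      using f' by (simp add: X.comp_cancel)
    finally show ?thesis .
  qed
  ultimately show ?thesis
    using iso(1) f' by (intro that[of ?h ?g \<gamma>]) simp_all
qed

lemma inducedI:
  assumes T: "left_triangle X \<Omega>' (h, g, f)" and \<Delta>: "(h\<^sub>0, g\<^sub>0, amap i f) \<in> \<Delta>"
    and \<gamma>: "is_iso X \<gamma>" "\<gamma> \<in> Arr X" "Dom X \<gamma> = Dom X g" "Cod X \<gamma> = omap Q (Dom C g\<^sub>0)"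
    and eqs: "\<gamma> \<cdot>\<^bsub>X\<^esub> h = amap Q h\<^sub>0" "\<eta> (Dom X f) \<cdot>\<^bsub>X\<^esub> g = amap Q g\<^sub>0 \<cdot>\<^bsub>X\<^esub> \<gamma>"
  shows "(h, g, f) \<in> \<Delta>'"
proof -
  have [simp]: "f \<in> Arr X" "g \<in> Arr X" "h \<in> Arr X" "Cod X g = Dom X f" "Cod X h = Dom X g"
      "Dom X h = omap \<Omega>' (Cod X f)" using T by auto
  note D [simp] = \<Delta>_arr[OF \<Delta>]
  have "g = \<kappa> (Dom X f) \<cdot>\<^bsub>X\<^esub> (\<eta> (Dom X f) \<cdot>\<^bsub>X\<^esub> g)"
    by (simp add: X.comp_cancel)
  then have g: "(\<kappa> (Dom X f) \<cdot>\<^bsub>X\<^esub> amap Q g\<^sub>0) \<cdot>\<^bsub>X\<^esub> \<gamma> = g"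
    using \<gamma> by (simp add: eqs(2))
  have "left_triangle_isomorphic X \<Omega>' (h, g, f) (amap Q h\<^sub>0, \<kappa> (Dom X f) \<cdot>\<^bsub>X\<^esub> amap Q g\<^sub>0, f)"
    unfolding left_triangle_isomorphic_def
    by (rule exI[of _ \<gamma>], rule exI[of _ "Id X (Dom X f)"], rule exI[of _ "Id X (Cod X f)"])
      (use \<gamma> eqs(1) g in \<open>simp add: Hom_def\<close>)
  then show ?thesis
    unfolding induced_left_triangles_def using \<Delta> \<open>f \<in> Arr X\<close> by blast
qed

lemma induced_iso_closed:
  assumes "T \<in> \<Delta>'" "left_triangle_isomorphic X \<Omega>' T T' \<or> left_triangle_isomorphic X \<Omega>' T' T"
  shows "T' \<in> \<Delta>'"
proof -
  have "left_triangle_isomorphic X \<Omega>' T' T"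
    using assms(2) left_triangle_isomorphic_sym \<Omega>'.cat_functor_axioms by blast
  then show ?thesis
    using assms(1) left_triangle_isomorphic_trans[OF \<Omega>'.cat_functor_axioms]
    unfolding induced_left_triangles_def by blast
qed

lemma standard_in_induced:
  assumes "f \<in> Arr X" "(h, g, amap i f) \<in> \<Delta>"
  shows "(amap Q h, \<kappa> (Dom X f) \<cdot>\<^bsub>X\<^esub> amap Q g, f) \<in> \<Delta>'"
proof -
  note D [simp] = \<Delta>_arr[OF assms(2)]
  show ?thesis
    by (rule inducedI[OF left_triangle_standard[OF assms] assms(2), of "Id X (omap Q (Dom C g))"])
      (use assms(1) in \<open>simp_all add: X.comp_cancel\<close>)
qed

text \<open>
  The coreflector carries a triangle of \<open>C\<close> to an induced triangle, once the first arrow is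
  composed with \<open>\<Omega>\<close> of the counit to start at \<open>\<Omega> i Q A\<close>.  This is where the second
  condition on a coreflective functor is used: it compares a triangle on \<open>f\<close> with one on
  \<open>i Q f\<close>.
\<close>

lemma coreflector_triangle:
  assumes \<Delta>: "(h, g, f) \<in> \<Delta>"
  shows "(amap Q (h \<cdot>\<^bsub>C\<^esub> amap \<Omega> (\<epsilon> (Cod C f))), amap Q g, amap Q f) \<in> \<Delta>'"
proof -
  note D [simp] = \<Delta>_arr[OF \<Delta>]
  let ?B = "Dom C f" and ?A = "Cod C f"
  obtain h' k' where \<Delta>2: "(h', k', amap i (amap Q f)) \<in> \<Delta>"
    using LT.LT1[of "amap i (amap Q f)"] by auto
  note D2 [simp] = \<Delta>_arr[OF \<Delta>2]
  obtain t where mor: "left_triangle_morphism C \<Omega> (h', k', amap i (amap Q f)) (h, g, f)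
      (t, \<epsilon> ?B, \<epsilon> ?A)"
    using LT.LT3[OF \<Delta>2 \<Delta>, of "\<epsilon> ?B" "\<epsilon> ?A"] counit_nat[of f] by (auto simp: Hom_def)
  then have "is_iso X (amap Q t)"
    using coreflects[OF D(1) \<Delta> \<Delta>2] by blast
  then obtain s where s: "inverse_arrows X (amap Q t) s"
    by (auto simp: is_iso_def)
  have [simp]: "t \<in> Arr C" "Dom C t = Dom C k'" "Cod C t = Dom C g"
    and t: "t \<cdot>\<^bsub>C\<^esub> h' = h \<cdot>\<^bsub>C\<^esub> amap \<Omega> (\<epsilon> ?A)" "\<epsilon> ?B \<cdot>\<^bsub>C\<^esub> k' = g \<cdot>\<^bsub>C\<^esub> t"
    using mor by (auto simp: Hom_def)
  have [simp]: "s \<in> Arr X" "Dom X s = omap Q (Dom C g)" "Cod X s = omap Q (Dom C k')"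
    and st: "s \<cdot>\<^bsub>X\<^esub> amap Q t = Id X (omap Q (Dom C k'))"
    and ts: "amap Q t \<cdot>\<^bsub>X\<^esub> s = Id X (omap Q (Dom C g))"
    using s by (auto simp: inverse_arrows_def Hom_def)
  have "s \<cdot>\<^bsub>X\<^esub> amap Q (t \<cdot>\<^bsub>C\<^esub> h') = amap Q h'"
    using st by (simp add: X.comp_cancel)
  then have 1: "s \<cdot>\<^bsub>X\<^esub> amap Q (h \<cdot>\<^bsub>C\<^esub> amap \<Omega> (\<epsilon> ?A)) = amap Q h'"
    by (simp only: t(1))
  have "\<eta> (omap Q ?B) \<cdot>\<^bsub>X\<^esub> amap Q g = \<eta> (omap Q ?B) \<cdot>\<^bsub>X\<^esub> (amap Q (g \<cdot>\<^bsub>C\<^esub> t) \<cdot>\<^bsub>X\<^esub> s)"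
    using ts by simp
  also have "\<dots> = (\<eta> (omap Q ?B) \<cdot>\<^bsub>X\<^esub> amap Q (\<epsilon> ?B)) \<cdot>\<^bsub>X\<^esub> (amap Q k' \<cdot>\<^bsub>X\<^esub> s)"
    by (simp flip: t(2))
  also have "\<dots> = amap Q k' \<cdot>\<^bsub>X\<^esub> s"
    by (simp add: unit_counit)
  finally have 2: "\<eta> (omap Q ?B) \<cdot>\<^bsub>X\<^esub> amap Q g = amap Q k' \<cdot>\<^bsub>X\<^esub> s" .
  show ?thesis
    by (rule inducedI[OF _ \<Delta>2, of _ _ s])
      (use 1 2 X.inverse_arrows_sym[OF s] in \<open>auto simp: is_iso_def\<close>)
qed

lemma induced_LT1:
  assumes "f \<in> Arr X"
  shows "\<exists>h g. (h, g, f) \<in> \<Delta>'"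
proof -
  obtain h g where "(h, g, amap i f) \<in> \<Delta>"
    using LT.LT1[of "amap i f"] assms by auto
  then show ?thesis
    using standard_in_induced assms by blast
qed

lemma induced_LT1_id:
  assumes Z: "zero_object X Z" and A: "A \<in> Obj X"
  shows "(Zero X (omap \<Omega>' Z) A, Id X A, Zero X A Z) \<in> \<Delta>'"
proof -
  have ZO [simp]: "Z \<in> Obj X" using Z by (simp add: zero_object_def)
  have \<Delta>: "(Zero C (omap \<Omega> (omap i Z)) (omap i A), Id C (omap i A), amap i (Zero X A Z)) \<in> \<Delta>"
    using LT.LT1_id[OF i.amap_zero_object[OF Z]] A by simp
  show ?thesis
    by (rule inducedI[OF _ \<Delta>, of _ _ "\<eta> A"]) (use A in simp_all)
qed

lemma induced_LT2:
  assumes T: "(h, g, f) \<in> \<Delta>'"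
  shows "(neg X (amap \<Omega>' f), h, g) \<in> \<Delta>'"
proof -
  obtain h\<^sub>0 g\<^sub>0 \<gamma> where tri: "left_triangle X \<Omega>' (h, g, f)" and \<Delta>: "(h\<^sub>0, g\<^sub>0, amap i f) \<in> \<Delta>"
    and \<gamma>: "is_iso X \<gamma>" "\<gamma> \<in> Arr X" "Dom X \<gamma> = Dom X g" "Cod X \<gamma> = omap Q (Dom C g\<^sub>0)"
    and eqs: "\<gamma> \<cdot>\<^bsub>X\<^esub> h = amap Q h\<^sub>0" "\<eta> (Dom X f) \<cdot>\<^bsub>X\<^esub> g = amap Q g\<^sub>0 \<cdot>\<^bsub>X\<^esub> \<gamma>"
    using T by (rule inducedE)
  have [simp]: "f \<in> Arr X" "g \<in> Arr X" "h \<in> Arr X" "Cod X g = Dom X f" "Cod X h = Dom X g"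
      "Dom X h = omap \<Omega>' (Cod X f)" using tri by auto
  note D [simp] = \<Delta>_arr[OF \<Delta>]
  let ?B = "Dom X f"
  let ?n = "neg C (amap \<Omega> (amap i f)) \<cdot>\<^bsub>C\<^esub> amap \<Omega> (\<epsilon> (omap i ?B))"
  \<comment> \<open>The rotated triangle in \<open>C\<close> ends in \<open>g\<^sub>0\<close>; its image under \<open>Q\<close> is isomorphic to the rotated
    triangle in \<open>X\<close> by \<open>\<gamma>\<close> and the unit.\<close>
  have in': "(amap Q ?n, amap Q h\<^sub>0, amap Q g\<^sub>0) \<in> \<Delta>'"
    using coreflector_triangle[OF LT.LT2[OF \<Delta>]] by simp
  have "amap \<Omega> (\<epsilon> (omap i ?B) \<cdot>\<^bsub>C\<^esub> amap i (\<eta> ?B)) = Id C (omap \<Omega> (omap i ?B))"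
    using triangle_L[of ?B] by simp
  then have "amap \<Omega> (\<epsilon> (omap i ?B)) \<cdot>\<^bsub>C\<^esub> amap \<Omega> (amap i (\<eta> ?B)) = Id C (omap \<Omega> (omap i ?B))"
    by simp
  then have "?n \<cdot>\<^bsub>C\<^esub> amap \<Omega> (amap i (\<eta> ?B)) = neg C (amap \<Omega> (amap i f))"
    by simp
  then have "amap Q (neg C (amap \<Omega> (amap i f))) = amap Q (?n \<cdot>\<^bsub>C\<^esub> amap \<Omega> (amap i (\<eta> ?B)))"
    by (simp only:)
  then have n: "neg X (amap \<Omega>' f) = amap Q ?n \<cdot>\<^bsub>X\<^esub> amap \<Omega>' (\<eta> ?B)"
    by simp
  have "left_triangle_isomorphic X \<Omega>' (neg X (amap \<Omega>' f), h, g) (amap Q ?n, amap Q h\<^sub>0, amap Q g\<^sub>0)"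
    unfolding left_triangle_isomorphic_def
    by (rule exI[of _ "Id X (omap \<Omega>' (Cod X f))"], rule exI[of _ \<gamma>], rule exI[of _ "\<eta> ?B"])
      (use \<gamma> eqs n in \<open>simp add: Hom_def\<close>)
  then show ?thesis
    using in' induced_iso_closed by blast
qed

lemma induced_LT3:
  assumes T: "(h, g, f) \<in> \<Delta>'" and T': "(h', g', f') \<in> \<Delta>'"
    and \<beta>: "\<beta> \<in> Hom X (Dom X f) (Dom X f')" and \<alpha>: "\<alpha> \<in> Hom X (Cod X f) (Cod X f')"
    and sq: "\<alpha> \<cdot>\<^bsub>X\<^esub> f = f' \<cdot>\<^bsub>X\<^esub> \<beta>"
  shows "\<exists>\<gamma>. left_triangle_morphism X \<Omega>' (h, g, f) (h', g', f') (\<gamma>, \<beta>, \<alpha>)"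
proof -
  obtain h\<^sub>0 g\<^sub>0 c where tri: "left_triangle X \<Omega>' (h, g, f)" and \<Delta>: "(h\<^sub>0, g\<^sub>0, amap i f) \<in> \<Delta>"
    and c [simp]: "c \<in> Arr X" "Dom X c = Dom X g" "Cod X c = omap Q (Dom C g\<^sub>0)"
    and eqs: "c \<cdot>\<^bsub>X\<^esub> h = amap Q h\<^sub>0" "\<eta> (Dom X f) \<cdot>\<^bsub>X\<^esub> g = amap Q g\<^sub>0 \<cdot>\<^bsub>X\<^esub> c"
    using T by (rule inducedE)
  obtain h\<^sub>0' g\<^sub>0' c' where tri': "left_triangle X \<Omega>' (h', g', f')"
    and \<Delta>': "(h\<^sub>0', g\<^sub>0', amap i f') \<in> \<Delta>"
    and c': "is_iso X c'" "c' \<in> Arr X" "Dom X c' = Dom X g'" "Cod X c' = omap Q (Dom C g\<^sub>0')"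
    and eqs': "c' \<cdot>\<^bsub>X\<^esub> h' = amap Q h\<^sub>0'" "\<eta> (Dom X f') \<cdot>\<^bsub>X\<^esub> g' = amap Q g\<^sub>0' \<cdot>\<^bsub>X\<^esub> c'"
    using T' by (rule inducedE)
  note [simp] = c'(2-4) \<Delta>_arr[OF \<Delta>] \<Delta>_arr[OF \<Delta>']
  have [simp]: "f \<in> Arr X" "g \<in> Arr X" "h \<in> Arr X" "Cod X g = Dom X f" "Cod X h = Dom X g"
      "Dom X h = omap \<Omega>' (Cod X f)"
      "f' \<in> Arr X" "g' \<in> Arr X" "h' \<in> Arr X" "Cod X g' = Dom X f'" "Cod X h' = Dom X g'"
      "Dom X h' = omap \<Omega>' (Cod X f')"
      "\<beta> \<in> Arr X" "Dom X \<beta> = Dom X f" "Cod X \<beta> = Dom X f'"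
      "\<alpha> \<in> Arr X" "Dom X \<alpha> = Cod X f" "Cod X \<alpha> = Cod X f'"
    using tri tri' \<alpha> \<beta> by (auto simp: Hom_def)
  obtain d where d': "inverse_arrows X c' d"
    using c'(1) by (auto simp: is_iso_def)
  have [simp]: "d \<in> Arr X" "Dom X d = omap Q (Dom C g\<^sub>0')" "Cod X d = Dom X g'"
    and dc: "d \<cdot>\<^bsub>X\<^esub> c' = Id X (Dom X g')" and cd: "c' \<cdot>\<^bsub>X\<^esub> d = Id X (omap Q (Dom C g\<^sub>0'))"
    using d' by (auto simp: inverse_arrows_def Hom_def)
  have "amap i (\<alpha> \<cdot>\<^bsub>X\<^esub> f) = amap i (f' \<cdot>\<^bsub>X\<^esub> \<beta>)"
    by (simp only: sq)
  then have "amap i \<alpha> \<cdot>\<^bsub>C\<^esub> amap i f = amap i f' \<cdot>\<^bsub>C\<^esub> amap i \<beta>"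
    by simp
  then obtain \<gamma> where mor: "left_triangle_morphism C \<Omega> (h\<^sub>0, g\<^sub>0, amap i f) (h\<^sub>0', g\<^sub>0', amap i f')
      (\<gamma>, amap i \<beta>, amap i \<alpha>)"
    using LT.LT3[OF \<Delta> \<Delta>', of "amap i \<beta>" "amap i \<alpha>"] by (auto simp: Hom_def)
  then have [simp]: "\<gamma> \<in> Arr C" "Dom C \<gamma> = Dom C g\<^sub>0" "Cod C \<gamma> = Dom C g\<^sub>0'"
    and m: "\<gamma> \<cdot>\<^bsub>C\<^esub> h\<^sub>0 = h\<^sub>0' \<cdot>\<^bsub>C\<^esub> amap \<Omega> (amap i \<alpha>)" "amap i \<beta> \<cdot>\<^bsub>C\<^esub> g\<^sub>0 = g\<^sub>0' \<cdot>\<^bsub>C\<^esub> \<gamma>"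
    by (auto simp: Hom_def)
  have Qm: "amap Q \<gamma> \<cdot>\<^bsub>X\<^esub> amap Q h\<^sub>0 = amap Q h\<^sub>0' \<cdot>\<^bsub>X\<^esub> amap \<Omega>' \<alpha>"
    "amap Q (amap i \<beta>) \<cdot>\<^bsub>X\<^esub> amap Q g\<^sub>0 = amap Q g\<^sub>0' \<cdot>\<^bsub>X\<^esub> amap Q \<gamma>"
    using arg_cong[OF m(1), of "amap Q"] arg_cong[OF m(2), of "amap Q"] by simp_all
  \<comment> \<open>\<open>\<gamma>\<close> in \<open>C\<close>, conjugated by the comparison isomorphisms \<open>c\<close> and \<open>c'\<close>.\<close>
  let ?\<gamma> = "d \<cdot>\<^bsub>X\<^esub> (amap Q \<gamma> \<cdot>\<^bsub>X\<^esub> c)"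
  have "?\<gamma> \<cdot>\<^bsub>X\<^esub> h = d \<cdot>\<^bsub>X\<^esub> (amap Q \<gamma> \<cdot>\<^bsub>X\<^esub> amap Q h\<^sub>0)"
    by (simp add: eqs)
  also have "\<dots> = (d \<cdot>\<^bsub>X\<^esub> (c' \<cdot>\<^bsub>X\<^esub> h')) \<cdot>\<^bsub>X\<^esub> amap \<Omega>' \<alpha>"
    unfolding Qm(1) eqs'(1) by simp
  also have "\<dots> = h' \<cdot>\<^bsub>X\<^esub> amap \<Omega>' \<alpha>"
    using X.comp_cancel[OF dc, of h'] by simp
  finally have 1: "?\<gamma> \<cdot>\<^bsub>X\<^esub> h = h' \<cdot>\<^bsub>X\<^esub> amap \<Omega>' \<alpha>" .
  let ?B = "Dom X f'"
  \<comment> \<open>The second square is checked after composing with the unit, which is invertible.\<close>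
  have "\<eta> ?B \<cdot>\<^bsub>X\<^esub> (g' \<cdot>\<^bsub>X\<^esub> ?\<gamma>) = (\<eta> ?B \<cdot>\<^bsub>X\<^esub> g') \<cdot>\<^bsub>X\<^esub> ?\<gamma>"
    by simp
  also have "\<dots> = amap Q g\<^sub>0' \<cdot>\<^bsub>X\<^esub> (amap Q \<gamma> \<cdot>\<^bsub>X\<^esub> c)"
    unfolding eqs'(2) by (simp add: X.comp_cancel[OF cd])
  also have "\<dots> = amap Q (amap i \<beta>) \<cdot>\<^bsub>X\<^esub> (amap Q g\<^sub>0 \<cdot>\<^bsub>X\<^esub> c)"
    by (rule X.comp_cong[OF Qm(2)[symmetric]]) simp_all
  also have "\<dots> = (\<eta> ?B \<cdot>\<^bsub>X\<^esub> \<beta>) \<cdot>\<^bsub>X\<^esub> g"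
    using unit_nat[of \<beta>] by (simp add: eqs(2)[symmetric])
  finally have "\<eta> ?B \<cdot>\<^bsub>X\<^esub> (g' \<cdot>\<^bsub>X\<^esub> ?\<gamma>) = \<eta> ?B \<cdot>\<^bsub>X\<^esub> (\<beta> \<cdot>\<^bsub>X\<^esub> g)"
    by simp
  then have "\<kappa> ?B \<cdot>\<^bsub>X\<^esub> (\<eta> ?B \<cdot>\<^bsub>X\<^esub> (g' \<cdot>\<^bsub>X\<^esub> ?\<gamma>)) = \<kappa> ?B \<cdot>\<^bsub>X\<^esub> (\<eta> ?B \<cdot>\<^bsub>X\<^esub> (\<beta> \<cdot>\<^bsub>X\<^esub> g))"
    by (simp only:)
  then have 2: "g' \<cdot>\<^bsub>X\<^esub> ?\<gamma> = \<beta> \<cdot>\<^bsub>X\<^esub> g"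
    by (simp add: X.comp_cancel[of "\<kappa> ?B" "\<eta> ?B" ?B])
  show ?thesis
    by (rule exI[of _ ?\<gamma>]) (use 1 2 sq in \<open>simp add: Hom_def\<close>)
qed

lemma induced_LT4:
  assumes [simp]: "g \<in> Arr X" "f \<in> Arr X" "Cod X g = Dom X f"
  shows "\<exists>m k n h a l \<alpha> \<beta>.
    (m, k, g) \<in> \<Delta>' \<and> (n, h, f \<cdot>\<^bsub>X\<^esub> g) \<in> \<Delta>' \<and> (a, l, f) \<in> \<Delta>' \<and>
    \<alpha> \<in> Hom X (Dom X k) (Dom X h) \<and> \<beta> \<in> Hom X (Dom X h) (Dom X l) \<and>
    \<alpha> \<cdot>\<^bsub>X\<^esub> m = n \<cdot>\<^bsub>X\<^esub> amap \<Omega>' f \<and> h \<cdot>\<^bsub>X\<^esub> \<alpha> = k \<and> \<beta> \<cdot>\<^bsub>X\<^esub> n = a \<and> l \<cdot>\<^bsub>X\<^esub> \<beta> = g \<cdot>\<^bsub>X\<^esub> h \<and>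
    (m \<cdot>\<^bsub>X\<^esub> amap \<Omega>' l, \<alpha>, \<beta>) \<in> \<Delta>'"
proof -
  obtain m k n h a l \<alpha> \<beta> where \<Delta>: "(m, k, amap i g) \<in> \<Delta>" "(n, h, amap i (f \<cdot>\<^bsub>X\<^esub> g)) \<in> \<Delta>"
      "(a, l, amap i f) \<in> \<Delta>"
    and hom: "\<alpha> \<in> Hom C (Dom C k) (Dom C h)" "\<beta> \<in> Hom C (Dom C h) (Dom C l)"
    and eqs: "\<alpha> \<cdot>\<^bsub>C\<^esub> m = n \<cdot>\<^bsub>C\<^esub> amap \<Omega> (amap i f)" "h \<cdot>\<^bsub>C\<^esub> \<alpha> = k" "\<beta> \<cdot>\<^bsub>C\<^esub> n = a"
      "l \<cdot>\<^bsub>C\<^esub> \<beta> = amap i g \<cdot>\<^bsub>C\<^esub> h"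
    and oct: "(m \<cdot>\<^bsub>C\<^esub> amap \<Omega> l, \<alpha>, \<beta>) \<in> \<Delta>"
    using LT.LT4[of "amap i g" "amap i f"] by auto
  note [simp] = \<Delta>_arr[OF \<Delta>(1)] \<Delta>_arr[OF \<Delta>(2), simplified] \<Delta>_arr[OF \<Delta>(3)]
  have [simp]: "\<alpha> \<in> Arr C" "Dom C \<alpha> = Dom C k" "Cod C \<alpha> = Dom C h"
    "\<beta> \<in> Arr C" "Dom C \<beta> = Dom C h" "Cod C \<beta> = Dom C l"
    using hom by (auto simp: Hom_def)
  let ?B = "Dom X f" and ?C = "Dom X g"
  let ?k = "\<kappa> ?C \<cdot>\<^bsub>X\<^esub> amap Q k" and ?h = "\<kappa> ?C \<cdot>\<^bsub>X\<^esub> amap Q h" and ?l = "\<kappa> ?B \<cdot>\<^bsub>X\<^esub> amap Q l"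
  have Qeqs: "amap Q \<alpha> \<cdot>\<^bsub>X\<^esub> amap Q m = amap Q n \<cdot>\<^bsub>X\<^esub> amap \<Omega>' f" "amap Q h \<cdot>\<^bsub>X\<^esub> amap Q \<alpha> = amap Q k"
    "amap Q \<beta> \<cdot>\<^bsub>X\<^esub> amap Q n = amap Q a" "amap Q l \<cdot>\<^bsub>X\<^esub> amap Q \<beta> = amap Q (amap i g) \<cdot>\<^bsub>X\<^esub> amap Q h"
    using eqs[THEN arg_cong[of _ _ "amap Q"]] by simp_all
  have "?l \<cdot>\<^bsub>X\<^esub> amap Q \<beta> = (\<kappa> ?B \<cdot>\<^bsub>X\<^esub> amap Q (amap i g)) \<cdot>\<^bsub>X\<^esub> amap Q h"
    by (simp add: Qeqs(4))
  also have "\<dots> = g \<cdot>\<^bsub>X\<^esub> ?h"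
    using \<kappa>_nat[of g] by simp
  finally have l\<beta>: "?l \<cdot>\<^bsub>X\<^esub> amap Q \<beta> = g \<cdot>\<^bsub>X\<^esub> ?h" .
  \<comment> \<open>Since \<open>i \<kappa> = \<epsilon>\<close>, the first arrow of the required triangle is the one that
    \<open>coreflector_triangle\<close> yields for the last triangle of the octahedron in \<open>C\<close>.\<close>
  have "amap i ?l = l \<cdot>\<^bsub>C\<^esub> \<epsilon> (Dom C l)"
    using counit_nat[of l] by (simp add: unit_inverse(2))
  then have "amap Q m \<cdot>\<^bsub>X\<^esub> amap \<Omega>' ?l = amap Q (m \<cdot>\<^bsub>C\<^esub> amap \<Omega> (l \<cdot>\<^bsub>C\<^esub> \<epsilon> (Dom C l)))"
    by (simp del: i.amap_Comp)
  also have "\<dots> = amap Q ((m \<cdot>\<^bsub>C\<^esub> amap \<Omega> l) \<cdot>\<^bsub>C\<^esub> amap \<Omega> (\<epsilon> (Cod C \<beta>)))"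
    by simp
  finally have "(amap Q m \<cdot>\<^bsub>X\<^esub> amap \<Omega>' ?l, amap Q \<alpha>, amap Q \<beta>) \<in> \<Delta>'"
    using coreflector_triangle[OF oct] by (simp only:)
  moreover have "(amap Q m, ?k, g) \<in> \<Delta>'" "(amap Q n, ?h, f \<cdot>\<^bsub>X\<^esub> g) \<in> \<Delta>'" "(amap Q a, ?l, f) \<in> \<Delta>'"
    using standard_in_induced[OF _ \<Delta>(1)] standard_in_induced[OF _ \<Delta>(2)]
      standard_in_induced[OF _ \<Delta>(3)] by simp_all
  moreover have "amap Q \<alpha> \<in> Hom X (Dom X ?k) (Dom X ?h)" "amap Q \<beta> \<in> Hom X (Dom X ?h) (Dom X ?l)"
    by (simp_all add: Hom_def)
  moreover have "?h \<cdot>\<^bsub>X\<^esub> amap Q \<alpha> = ?k"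
    by (simp add: Qeqs(2))
  ultimately show ?thesis
    using Qeqs(1,3) l\<beta> by blast
qed

theorem induced_left_triangulated: "left_triangulated X \<Omega>' \<Delta>'"
proof (intro left_triangulated.intro left_triangulated_axioms.intro)
  show "left_triangle X \<Omega>' T" if "T \<in> \<Delta>'" for T
  proof (cases T)
    case (fields h g f)
    with that have "(h, g, f) \<in> \<Delta>'" by simp
    then show ?thesis
      unfolding fields by (rule inducedE)
  qed
  show "T' \<in> \<Delta>'" if "T \<in> \<Delta>'" "left_triangle_isomorphic X \<Omega>' T T'" for T T'
    using that induced_iso_closed by blast
qed (fact X.additive_category_axioms \<Omega>'.additive_functor_axioms induced_LT1 induced_LT1_id
    induced_LT2 induced_LT3 induced_LT4)+

end

theorem coreflective_left_triangulated:
  assumes "left_triangulated C \<Omega> \<Delta>" "additive_category X" "left_coreflective C \<Omega> \<Delta> X i Q \<eta> \<epsilon>"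
  shows "left_triangulated X (Q \<circ>\<^sub>F \<Omega> \<circ>\<^sub>F i) (induced_left_triangles \<Omega> \<Delta> X i Q \<eta>)"
proof -
  have "coreflection C \<Omega> \<Delta> X i Q \<eta> \<epsilon>"
    using assms unfolding left_coreflective_def
    by (intro coreflection.intro coreflection_axioms.intro) blast+
  then show ?thesis
    by (rule coreflection.induced_left_triangulated)
qed

section \<open>Passage to the opposite category\<close>

lemma op_cat_simps [simp]:
  "Obj (op_cat C) = Obj C" "Arr (op_cat C) = Arr C" "Dom (op_cat C) = Cod C"
  "Cod (op_cat C) = Dom C" "Id (op_cat C) = Id C" "g \<cdot>\<^bsub>op_cat C\<^esub> f = f \<cdot>\<^bsub>C\<^esub> g"
  "Plus (op_cat C) = Plus C" "Zero (op_cat C) A B = Zero C B A"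
  by (simp_all add: op_cat_def)

lemma Hom_op_cat [simp]: "Hom (op_cat C) A B = Hom C B A"
  by (auto simp: Hom_def)

lemma inverse_arrows_op_cat [simp]: "inverse_arrows (op_cat C) f g \<longleftrightarrow> inverse_arrows C f g"
  by (auto simp: inverse_arrows_def Hom_def)

lemma is_iso_op_cat [simp]: "is_iso (op_cat C) f \<longleftrightarrow> is_iso C f"
  by (simp add: is_iso_def)

lemma inv_arr_op_cat [simp]: "inv_arr (op_cat C) f = inv_arr C f"
  by (simp add: inv_arr_def)

lemma op_cat_op_cat [simp]: "op_cat (op_cat C) = C"
  by (simp add: op_cat_def)

lemma zero_object_op_cat [simp]: "zero_object (op_cat C) Z \<longleftrightarrow> zero_object C Z"
  by (auto simp: zero_object_def)

lemma hom_group_op_cat [simp]: "hom_group (op_cat C) A B = hom_group C B A"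
  by (simp add: hom_group_def)

lemma category_op:
  assumes "category C"
  shows "category (op_cat C)"
proof -
  interpret category C by fact
  show ?thesis
    by unfold_locales (auto simp: Hom_def)
qed

lemma additive_category_op:
  assumes "additive_category C"
  shows "additive_category (op_cat C)"
proof -
  interpret additive_category C by fact
  show ?thesis
  proof (intro additive_category.intro additive_category_axioms.intro category_op)
    fix A B assume "A \<in> Obj (op_cat C)" "B \<in> Obj (op_cat C)"
    then obtain P i\<^sub>1 i\<^sub>2 p\<^sub>1 p\<^sub>2 where
      "i\<^sub>1 \<in> Hom C A P \<and> i\<^sub>2 \<in> Hom C B P \<and> p\<^sub>1 \<in> Hom C P A \<and> p\<^sub>2 \<in> Hom C P B \<and>
        p\<^sub>1 \<cdot>\<^bsub>C\<^esub> i\<^sub>1 = Id C A \<and> p\<^sub>2 \<cdot>\<^bsub>C\<^esub> i\<^sub>2 = Id C B \<and> p\<^sub>2 \<cdot>\<^bsub>C\<^esub> i\<^sub>1 = Zero C A B \<and> p\<^sub>1 \<cdot>\<^bsub>C\<^esub> i\<^sub>2 = Zero C B A \<and>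
        (i\<^sub>1 \<cdot>\<^bsub>C\<^esub> p\<^sub>1) \<oplus>\<^bsub>C\<^esub> (i\<^sub>2 \<cdot>\<^bsub>C\<^esub> p\<^sub>2) = Id C P"
      using has_biproducts[of A B] by auto
    then show "\<exists>P i\<^sub>1 i\<^sub>2 p\<^sub>1 p\<^sub>2. i\<^sub>1 \<in> Hom (op_cat C) A P \<and> i\<^sub>2 \<in> Hom (op_cat C) B P \<and>
        p\<^sub>1 \<in> Hom (op_cat C) P A \<and> p\<^sub>2 \<in> Hom (op_cat C) P B \<and>
        p\<^sub>1 \<cdot>\<^bsub>op_cat C\<^esub> i\<^sub>1 = Id (op_cat C) A \<and> p\<^sub>2 \<cdot>\<^bsub>op_cat C\<^esub> i\<^sub>2 = Id (op_cat C) B \<and>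
        p\<^sub>2 \<cdot>\<^bsub>op_cat C\<^esub> i\<^sub>1 = Zero (op_cat C) A B \<and> p\<^sub>1 \<cdot>\<^bsub>op_cat C\<^esub> i\<^sub>2 = Zero (op_cat C) B A \<and>
        (i\<^sub>1 \<cdot>\<^bsub>op_cat C\<^esub> p\<^sub>1) \<oplus>\<^bsub>op_cat C\<^esub> (i\<^sub>2 \<cdot>\<^bsub>op_cat C\<^esub> p\<^sub>2) = Id (op_cat C) P"
      by (intro exI[of _ P] exI[of _ p\<^sub>1] exI[of _ p\<^sub>2] exI[of _ i\<^sub>1] exI[of _ i\<^sub>2]) auto
  qed (use has_zero_object category_axioms in \<open>auto simp: hom_group comp_plus_left comp_plus_right\<close>)
qed

lemma cat_functor_op:
  assumes "cat_functor C D F"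
  shows "cat_functor (op_cat C) (op_cat D) F"
proof -
  interpret cat_functor C D F by fact
  show ?thesis
    by (intro cat_functor.intro category_op cat_functor_axioms.intro)
      (unfold_locales, auto simp: Hom_def)
qed

lemma fully_faithful_functor_op:
  assumes "fully_faithful_functor C D F"
  shows "fully_faithful_functor (op_cat C) (op_cat D) F"
proof -
  interpret fully_faithful_functor C D F by fact
  show ?thesis
    by (intro fully_faithful_functor.intro cat_functor_op fully_faithful_functor_axioms.intro)
      (unfold_locales, simp add: amap_bij)
qed

text \<open>In the opposite categories the adjoints and their unit and counit exchange roles.\<close>

lemma adjunction_op:
  assumes "adjunction C D L R \<eta> \<epsilon>"
  shows "adjunction (op_cat D) (op_cat C) R L \<epsilon> \<eta>"
proof -
  interpret adjunction C D L R \<eta> \<epsilon> by fact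
  show ?thesis
    by (intro adjunction.intro cat_functor_op adjunction_axioms.intro)
      (unfold_locales, auto simp: Hom_def unit_nat counit_nat triangle_L triangle_R)
qed

text \<open>Passage to the opposite category reverses morphisms of triangles.\<close>

lemma left_triangle_morphism_op_cat:
  "left_triangle_morphism (op_cat C) \<Sigma> (op_triangle T') (op_triangle T) (\<gamma>, \<beta>, \<alpha>)
    \<longleftrightarrow> right_triangle_morphism C \<Sigma> T T' (\<alpha>, \<beta>, \<gamma>)"
  by (cases T; cases T') auto

lemma left_triangle_isomorphic_op_cat:
  "left_triangle_isomorphic (op_cat C) \<Sigma> (op_triangle T') (op_triangle T)
    \<longleftrightarrow> right_triangle_isomorphic C \<Sigma> T T'"
  unfolding left_triangle_isomorphic_def right_triangle_isomorphic_def
    left_triangle_morphism_op_cat is_iso_op_cat by blast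

lemma op_triangle_op_triangle [simp]: "op_triangle (op_triangle T) = T"
  by (cases T) simp

lemma in_op_triangle_image: "T \<in> op_triangle ` \<V> \<longleftrightarrow> op_triangle T \<in> \<V>"
proof
  assume "op_triangle T \<in> \<V>"
  then have "op_triangle (op_triangle T) \<in> op_triangle ` \<V>"
    by (rule imageI)
  then show "T \<in> op_triangle ` \<V>"
    by simp
qed auto

lemma left_coreflective_op_cat:
  assumes "right_reflective D \<Sigma> \<V> Y j R \<zeta> \<theta>"
  shows "left_coreflective (op_cat D) \<Sigma> (op_triangle ` \<V>) (op_cat Y) j R \<theta> \<zeta>"
proof -
  have "is_iso Y (amap R t)"
    if "f \<in> Arr D" "(f, g, h) \<in> \<V>" "(amap j (amap R f), g', h') \<in> \<V>"
      and mor: "left_triangle_morphism (op_cat D) \<Sigma> (h', g', amap j (amap R f)) (h, g, f)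
        (t, \<zeta> (Cod D f), \<zeta> (Dom D f))" for f g h g' h' t
  proof -
    have "right_triangle_morphism D \<Sigma> (f, g, h) (amap j (amap R f), g', h')
        (\<zeta> (Dom D f), \<zeta> (Cod D f), t)"
      using mor left_triangle_morphism_op_cat[of D \<Sigma> "(amap j (amap R f), g', h')" "(f, g, h)"]
      by simp
    then show ?thesis
      using assms that(1-3) unfolding right_reflective_def by blast
  qed
  then show ?thesis
    using assms fully_faithful_functor_op[of Y D j] adjunction_op[of D Y R j \<zeta> \<theta>]
    unfolding left_coreflective_def right_reflective_def
    by (simp add: in_op_triangle_image del: left_triangle_morphism.simps)
qed

lemma induced_right_triangles_op:
  assumes "cat_functor Y Y (R \<circ>\<^sub>F \<Sigma> \<circ>\<^sub>F j)"
  shows "op_triangle ` induced_right_triangles \<Sigma> \<V> Y j R \<theta>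
    = induced_left_triangles \<Sigma> (op_triangle ` \<V>) (op_cat Y) j R \<theta>"
proof -
  have iso: "left_triangle_isomorphic (op_cat Y) (R \<circ>\<^sub>F \<Sigma> \<circ>\<^sub>F j) (op_triangle T) (h, g, f)
    \<longleftrightarrow> right_triangle_isomorphic Y (R \<circ>\<^sub>F \<Sigma> \<circ>\<^sub>F j) T (f, g, h)" for T f g h
    \<comment> \<open>The two definitions compare \<open>T\<close> with its model in opposite directions.\<close>
    using left_triangle_isomorphic_sym[OF cat_functor_op[OF assms]]
      left_triangle_isomorphic_op_cat[of Y "R \<circ>\<^sub>F \<Sigma> \<circ>\<^sub>F j" "(f, g, h)" T]
    unfolding op_triangle.simps by blast
  have mem: "op_triangle T \<in> induced_left_triangles \<Sigma> (op_triangle ` \<V>) (op_cat Y) j R \<theta>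
    \<longleftrightarrow> T \<in> induced_right_triangles \<Sigma> \<V> Y j R \<theta>" for T
    unfolding induced_left_triangles_def induced_right_triangles_def mem_Collect_eq iso
    by (auto simp: in_op_triangle_image)
  show ?thesis
    by (rule Set.set_eqI) (simp add: in_op_triangle_image mem[symmetric])
qed

theorem reflective_right_triangulated:
  assumes "right_triangulated D \<Sigma> \<V>" "additive_category Y" "right_reflective D \<Sigma> \<V> Y j R \<zeta> \<theta>"
  shows "right_triangulated Y (R \<circ>\<^sub>F \<Sigma> \<circ>\<^sub>F j) (induced_right_triangles \<Sigma> \<V> Y j R \<theta>)"
proof -
  have *: "left_triangulated (op_cat Y) (R \<circ>\<^sub>F \<Sigma> \<circ>\<^sub>F j)
      (induced_left_triangles \<Sigma> (op_triangle ` \<V>) (op_cat Y) j R \<theta>)"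
    using assms(1) unfolding right_triangulated_def
    by (rule coreflective_left_triangulated)
      (rule additive_category_op[OF assms(2)], rule left_coreflective_op_cat[OF assms(3)])
  interpret op: left_triangulated "op_cat Y" "R \<circ>\<^sub>F \<Sigma> \<circ>\<^sub>F j"
    "induced_left_triangles \<Sigma> (op_triangle ` \<V>) (op_cat Y) j R \<theta>"
    by (rule *)
  have "cat_functor Y Y (R \<circ>\<^sub>F \<Sigma> \<circ>\<^sub>F j)"
    using cat_functor_op[OF op.cat_functor_axioms] by simp
  then show ?thesis
    using * by (simp add: right_triangulated_def induced_right_triangles_op)
qed

theorem proposition2p4:
  fixes C :: "('o, 'a) acat" and \<Omega> :: "('o, 'a, 'o, 'a) func" and \<Delta> :: "'a triangle set"
    and X :: "('p, 'b) acat" and i :: "('p, 'b, 'o, 'a) func" and Q :: "('o, 'a, 'p, 'b) func"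
    and \<eta> :: "'p \<Rightarrow> 'b" and \<epsilon> :: "'o \<Rightarrow> 'a"
    and D :: "('q, 'c) acat" and \<Sigma> :: "('q, 'c, 'q, 'c) func" and \<V> :: "'c triangle set"
    and Y :: "('r, 'd) acat" and j :: "('r, 'd, 'q, 'c) func" and R :: "('q, 'c, 'r, 'd) func"
    and \<zeta> :: "'q \<Rightarrow> 'c" and \<theta> :: "'r \<Rightarrow> 'd"
  shows "(left_triangulated C \<Omega> \<Delta> \<and> additive_category X \<and> left_coreflective C \<Omega> \<Delta> X i Q \<eta> \<epsilon> \<longrightarrow>
            left_triangulated X (Q \<circ>\<^sub>F \<Omega> \<circ>\<^sub>F i) (induced_left_triangles \<Omega> \<Delta> X i Q \<eta>)) \<and>
         (right_triangulated D \<Sigma> \<V> \<and> additive_category Y \<and> right_reflective D \<Sigma> \<V> Y j R \<zeta> \<theta> \<longrightarrow>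
            right_triangulated Y (R \<circ>\<^sub>F \<Sigma> \<circ>\<^sub>F j) (induced_right_triangles \<Sigma> \<V> Y j R \<theta>))"
  by (intro conjI impI coreflective_left_triangulated[where C = C and \<epsilon> = \<epsilon>]
      reflective_right_triangulated[where D = D and \<zeta> = \<zeta>]) simp_all

end
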